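(* Let $\mathcal{M}$ be a von Neumann algebra, $\omega_0$ a normal state on $\mathcal{M}$, and let $\{Q^{s,t}:\mathcal{M}\to\mathcal{M}\}$ and $\{H^{s,t}:\mathcal{M}\otimes\mathcal{M}\to\mathcal{M}\otimes\mathcal{M}\}$ ($s,t\in\mathbb{R}_+$, $t-s\ge 1$) be two Markov processes. For $t\ge 1$ put $\varphi_t(x)=\omega_0(Q^{0,t}x)$ and $\psi_t(x)=(\omega_0\otimes\omega_0)(H^{0,t}(x\otimes\mathbf{1}))$, $x\in\mathcal{M}$, and put $\varphi_0=\psi_0=\omega_0$. Assume that for all $s,t$ with $t-s\ge 1$: (i) $UH^{s,t}=H^{s,t}$; (ii) $E_{\psi_s}H^{s,t}\mathbf{x}=Q^{s,t}E_{\varphi_t}\mathbf{x}$ for all $\mathbf{x}\in\mathcal{M}\otimes\mathcal{M}$ (for $s\in\{0\}\cup[1,\infty)$, where $\psi_s$ is defined); (iii) $H^{s,t}\mathbf{x}=H^{s,t}(E_{\psi_t}(\mathbf{x})\otimes\mathbf{1})$ for all $\mathbf{x}\in\mathcal{M}\otimes\mathcal{M}$. (These conditions force $\varphi_t=\psi_t$; write $\omega_t:=\varphi_t=\psi_t$.) Then the operators $P^{s,t}:\mathcal{M}\to\mathcal{M}\otimes\mathcal{M}$ defined by $P^{s,t}x=H^{s,t}(x\otimes\mathbf{1})$ form, together with the initial state $\omega_0$, a quantum quadratic stochastic process of type (A). Moreover: (a) $P^{s,t}=H^{s,\tau}P^{\tau,t}$ for all $s,\tau,t\in\mathbb{R}_+$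 with $\tau-s\ge 1$, $t-\tau\ge 1$; (b) $Q^{s,t}=E_{\omega_s}P^{s,t}$ for all $s\in\{0\}\cup[1,\infty)$ and $t$ with $t-s\ge1$.
   Context: $\mathcal{M}\otimes\mathcal{M}$ is the von Neumann algebra tensor product and $\mathbf{1}$ is the unit of $\mathcal{M}$. $U:\mathcal{M}\otimes\mathcal{M}\to\mathcal{M}\otimes\mathcal{M}$ is the flip, the ultraweakly continuous linear map with $U(x\otimes y)=y\otimes x$. For a normal state $\varphi$ on $\mathcal{M}$, $E_\varphi:\mathcal{M}\otimes\mathcal{M}\to\mathcal{M}$ is the slice map determined by $E_\varphi(a\otimes b)=\varphi(b)a$, extended by linearity and ultraweak continuity. A Markov process on a von Neumann algebra $\mathcal{N}$ is a family $\{T^{s,t}:\mathcal{N}\to\mathcal{N}: s,t\in\mathbb{R}_+,\ t-s\ge1\}$ of unital, completely positive, ultraweakly continuous linear operators such that $T^{s,t}=T^{s,\tau}T^{\tau,t}$ whenever $\tau-s\ge1$ and $t-\tau\ge1$. A quantum quadratic stochastic process of type (A) on $\mathcal{M}$ is a pair $(\{P^{s,t}\},\omega_0)$, where $\omega_0$ is a normal state on $\mathcal{M}$ and $\{P^{s,t}:\mathcal{M}\to\mathcal{M}\otimes\mathcal{M}: s,t\in\mathbb{R}_+,\ t-s\ge1\}$ is a family of ultraweakly continuous, unital, completely positive linear maps with $UP^{s,t}=P^{s,t}$, such that for all $s,\tau,t\in\mathbb{R}_+$ with $\tau-s\ge1$, $t-\tau\ge1$ one has $P^{s,t}x=P^{s,\tau}(E_{\omega_\tau}(P^{\tau,t}x))$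 for all $x\in\mathcal{M}$, where $\omega_\tau(x)=(\omega_0\otimes\omega_0)(P^{0,\tau}x)$ for $\tau\ge 1$. *)

theory Defs
  imports "HOL-Analysis.Analysis"
begin

section \<open>Complex Hilbert spaces\<close>

text \<open>The complex structures sit on top of the real library classes: a complex inner product
  space is a real inner product space whose real inner product is the real part of \<open>cinner\<close>,
  so norm, topology and completeness are those of the library.
  The inner product is conjugate-linear in the first argument.\<close>

class complex_vector = real_vector +
  fixes scaleC :: "complex \<Rightarrow> 'a \<Rightarrow> 'a" (infixr "*\<^sub>C" 75)
  assumes scaleC_add_right: "c *\<^sub>C (x + y) = c *\<^sub>C x + c *\<^sub>C y"
    and scaleC_add_left: "(c + d) *\<^sub>C x = c *\<^sub>C x + d *\<^sub>C x"
    and scaleC_scaleC: "c *\<^sub>C d *\<^sub>C x = (c * d) *\<^sub>C x"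
    and scaleC_of_real: "complex_of_real r *\<^sub>C x = r *\<^sub>R x"

class complex_inner = complex_vector + real_inner +
  fixes cinner :: "'a \<Rightarrow> 'a \<Rightarrow> complex"
  assumes cinner_commute: "cinner x y = cnj (cinner y x)"
    and cinner_add_right: "cinner x (y + z) = cinner x y + cinner x z"
    and cinner_scaleC_right: "cinner x (c *\<^sub>C y) = c * cinner x y"
    and inner_eq_Re_cinner: "inner x y = Re (cinner x y)"

class chilbert_space = complex_inner + complete_space

instantiation complex :: chilbert_space
begin

definition scaleC_complex :: "complex \<Rightarrow> complex \<Rightarrow> complex"
  where "scaleC_complex c z = c * z"

definition cinner_complex :: "complex \<Rightarrow> complex \<Rightarrow> complex"
  where "cinner_complex z w = cnj z * w"

instance
  by standard
    (auto simp: scaleC_complex_def cinner_complex_def algebra_simps inner_complex_def scaleR_conv_of_real)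

end

lemma norm_eq_sqrt_cinner: "norm (x :: 'a::complex_inner) = sqrt (Re (cinner x x))"
  by (simp add: norm_eq_sqrt_inner inner_eq_Re_cinner)

lemma cinner_scaleC_left: "cinner (c *\<^sub>C x) y = cnj c * cinner x y"
  for x y :: "'a::complex_inner"
  by (metis cinner_commute cinner_scaleC_right complex_cnj_mult)

lemma norm_scaleC: "norm (c *\<^sub>C x) = cmod c * norm x" for x :: "'a::complex_inner"
proof -
  have "cinner (c *\<^sub>C x) (c *\<^sub>C x) = (cnj c * c) * cinner x x"
    by (simp add: cinner_scaleC_right cinner_scaleC_left algebra_simps)
  also have "cnj c * c = complex_of_real ((cmod c)\<^sup>2)"
    by (metis complex_norm_square mult.commute)
  finally have "Re (cinner (c *\<^sub>C x) (c *\<^sub>C x)) = (cmod c)\<^sup>2 * Re (cinner x x)"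
    by simp
  then show ?thesis
    unfolding norm_eq_sqrt_cinner[of x] norm_eq_sqrt_cinner[of "c *\<^sub>C x"]
    by (simp add: real_sqrt_mult del: of_real_power)
qed

lemma bounded_linear_scaleC: "bounded_linear (\<lambda>x :: 'a::complex_inner. c *\<^sub>C x)"
proof (rule bounded_linear_intro[where K = "cmod c"])
  show "c *\<^sub>C (r *\<^sub>R x) = r *\<^sub>R (c *\<^sub>C x)" for r and x :: 'a
    by (simp add: scaleC_of_real[symmetric] scaleC_scaleC mult.commute)
qed (auto simp: scaleC_add_right norm_scaleC mult.commute)

instantiation blinfun :: (real_normed_vector, complex_inner) complex_vector
begin

definition scaleC_blinfun :: "complex \<Rightarrow> ('a \<Rightarrow>\<^sub>L 'b) \<Rightarrow> ('a \<Rightarrow>\<^sub>L 'b)"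
  where "scaleC_blinfun c T = Blinfun (\<lambda>x. c *\<^sub>C blinfun_apply T x)"

lemma scaleC_blinfun_apply: "blinfun_apply (c *\<^sub>C T) x = c *\<^sub>C blinfun_apply T x"
  for T :: "'a \<Rightarrow>\<^sub>L 'b"
  unfolding scaleC_blinfun_def
  by (simp add: bounded_linear_Blinfun_apply
      bounded_linear_compose[OF bounded_linear_scaleC blinfun.bounded_linear_right])

instance
  by standard
    (auto intro!: blinfun_eqI simp: scaleC_blinfun_apply blinfun.add_left blinfun.scaleR_left
      scaleC_add_right scaleC_add_left scaleC_scaleC scaleC_of_real)

end


section \<open>Von Neumann algebras\<close>

text \<open>The library type \<open>'a \<Rightarrow>\<^sub>L 'a\<close> consists of the bounded real-linear operators;
  \<open>bounded_ops\<close> is the usual algebra of bounded complex-linear operators inside it.\<close>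

definition bounded_ops :: "('a::chilbert_space \<Rightarrow>\<^sub>L 'a) set"
  where "bounded_ops = {T. \<forall>c x. blinfun_apply T (c *\<^sub>C x) = c *\<^sub>C blinfun_apply T x}"

definition is_adjoint :: "('a::chilbert_space \<Rightarrow>\<^sub>L 'a) \<Rightarrow> ('a \<Rightarrow>\<^sub>L 'a) \<Rightarrow> bool"
  where "is_adjoint S T \<longleftrightarrow>
    (\<forall>x y. cinner (blinfun_apply S x) y = cinner x (blinfun_apply T y))"

definition commutant :: "('a::chilbert_space \<Rightarrow>\<^sub>L 'a) set \<Rightarrow> ('a \<Rightarrow>\<^sub>L 'a) set"
  where "commutant A = {T \<in> bounded_ops. \<forall>S\<in>A. T o\<^sub>L S = S o\<^sub>L T}"

definition von_neumann_algebra :: "('a::chilbert_space \<Rightarrow>\<^sub>L 'a) set \<Rightarrow> bool"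
  where "von_neumann_algebra M \<longleftrightarrow>
    M \<subseteq> bounded_ops \<and> (\<forall>T\<in>M. \<exists>S\<in>M. is_adjoint S T) \<and> commutant (commutant M) = M"

text \<open>The ultraweak topology on \<open>bounded_ops\<close>: the initial topology for the functionals
  \<open>T \<mapsto> \<Sum>n. \<langle>\<eta>\<^sub>n, T \<xi>\<^sub>n\<rangle>\<close> with square-summable \<open>\<xi>\<close> and \<open>\<eta>\<close>.\<close>

definition ultraweak_functionals :: "(('a::chilbert_space \<Rightarrow>\<^sub>L 'a) \<Rightarrow> complex) set"
  where "ultraweak_functionals =
    {\<lambda>T. \<Sum>n. cinner (\<eta> n) (blinfun_apply T (\<xi> n)) | \<xi> \<eta> :: nat \<Rightarrow> 'a.
      summable (\<lambda>n. (norm (\<xi> n))\<^sup>2) \<and> summable (\<lambda>n. (norm (\<eta> n))\<^sup>2)}"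

definition ultraweak :: "('a::chilbert_space \<Rightarrow>\<^sub>L 'a) topology"
  where "ultraweak = subtopology
    (topology_generated_by {f -` V | f V. f \<in> ultraweak_functionals \<and> open V}) bounded_ops"


section \<open>Maps and states\<close>

definition clinear_on :: "'a::complex_vector set \<Rightarrow> ('a \<Rightarrow> 'b::complex_vector) \<Rightarrow> bool"
  where "clinear_on M f \<longleftrightarrow>
    (\<forall>x\<in>M. \<forall>y\<in>M. f (x + y) = f x + f y) \<and> (\<forall>c. \<forall>x\<in>M. f (c *\<^sub>C x) = c *\<^sub>C f x)"

definition ultraweakly_continuous_map ::
  "('a::chilbert_space \<Rightarrow>\<^sub>L 'a) set \<Rightarrow> ('b::chilbert_space \<Rightarrow>\<^sub>L 'b) set
    \<Rightarrow> (('a \<Rightarrow>\<^sub>L 'a) \<Rightarrow> ('b \<Rightarrow>\<^sub>L 'b)) \<Rightarrow> bool"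
  where "ultraweakly_continuous_map M N T \<longleftrightarrow>
    continuous_map (subtopology ultraweak M) (subtopology ultraweak N) T"

definition ultraweakly_continuous_functional ::
  "('a::chilbert_space \<Rightarrow>\<^sub>L 'a) set \<Rightarrow> (('a \<Rightarrow>\<^sub>L 'a) \<Rightarrow> complex) \<Rightarrow> bool"
  where "ultraweakly_continuous_functional M \<phi> \<longleftrightarrow>
    continuous_map (subtopology ultraweak M) euclidean \<phi>"

text \<open>An \<open>n \<times> n\<close> operator matrix is positive if it is a positive operator on the
  \<open>n\<close>-fold direct sum of the Hilbert space. Only the entries with indices below \<open>n\<close> matter.\<close>

definition positive_op :: "('a::chilbert_space \<Rightarrow>\<^sub>L 'a) \<Rightarrow> bool"
  where "positive_op T \<longleftrightarrow> (\<forall>x. cinner x (blinfun_apply T x) \<in> \<real>\<^sub>\<ge>\<^sub>0)"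

definition positive_matrix :: "nat \<Rightarrow> (nat \<Rightarrow> nat \<Rightarrow> ('a::chilbert_space \<Rightarrow>\<^sub>L 'a)) \<Rightarrow> bool"
  where "positive_matrix n X \<longleftrightarrow>
    (\<forall>\<xi>. (\<Sum>i<n. \<Sum>j<n. cinner (\<xi> i) (blinfun_apply (X i j) (\<xi> j))) \<in> \<real>\<^sub>\<ge>\<^sub>0)"

definition completely_positive_on ::
  "('a::chilbert_space \<Rightarrow>\<^sub>L 'a) set \<Rightarrow> (('a \<Rightarrow>\<^sub>L 'a) \<Rightarrow> ('b::chilbert_space \<Rightarrow>\<^sub>L 'b)) \<Rightarrow> bool"
  where "completely_positive_on M T \<longleftrightarrow>
    (\<forall>n X. (\<forall>i<n. \<forall>j<n. X i j \<in> M) \<longrightarrow> positive_matrix n X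
      \<longrightarrow> positive_matrix n (\<lambda>i j. T (X i j)))"

definition normal_ucp_map ::
  "('a::chilbert_space \<Rightarrow>\<^sub>L 'a) set \<Rightarrow> ('b::chilbert_space \<Rightarrow>\<^sub>L 'b) set
    \<Rightarrow> (('a \<Rightarrow>\<^sub>L 'a) \<Rightarrow> ('b \<Rightarrow>\<^sub>L 'b)) \<Rightarrow> bool"
  where "normal_ucp_map M N T \<longleftrightarrow>
    T \<in> M \<rightarrow> N \<and> clinear_on M T \<and> ultraweakly_continuous_map M N T \<and>
    T id_blinfun = id_blinfun \<and> completely_positive_on M T"

definition normal_state ::
  "('a::chilbert_space \<Rightarrow>\<^sub>L 'a) set \<Rightarrow> (('a \<Rightarrow>\<^sub>L 'a) \<Rightarrow> complex) \<Rightarrow> bool"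
  where "normal_state M \<phi> \<longleftrightarrow>
    clinear_on M \<phi> \<and> ultraweakly_continuous_functional M \<phi> \<and>
    (\<forall>x\<in>M. positive_op x \<longrightarrow> \<phi> x \<in> \<real>\<^sub>\<ge>\<^sub>0) \<and> \<phi> id_blinfun = 1"


section \<open>Tensor products\<close>

text \<open>\<open>hilbert_tensor t\<close> says that the codomain of \<open>t\<close>, with \<open>t x y\<close> as the simple tensors
  \<open>x \<otimes> y\<close>, is a Hilbert space tensor product of the two argument spaces.
  This determines it up to a unique unitary fixing the simple tensors.
  The real \<open>span\<close> suffices because the simple tensors are closed under complex scaling.\<close>

definition hilbert_tensor ::
  "('a::chilbert_space \<Rightarrow> 'b::chilbert_space \<Rightarrow> 'k::chilbert_space) \<Rightarrow> bool"
  where "hilbert_tensor t \<longleftrightarrow>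
    (\<forall>x x' y. t (x + x') y = t x y + t x' y) \<and>
    (\<forall>x y y'. t x (y + y') = t x y + t x y') \<and>
    (\<forall>c x y. t (c *\<^sub>C x) y = c *\<^sub>C t x y \<and> t x (c *\<^sub>C y) = c *\<^sub>C t x y) \<and>
    (\<forall>x x' y y'. cinner (t x y) (t x' y') = cinner x x' * cinner y y') \<and>
    closure (span {t x y | x y. True}) = UNIV"

definition op_tensor ::
  "('a::chilbert_space \<Rightarrow> 'b::chilbert_space \<Rightarrow> 'k::chilbert_space)
    \<Rightarrow> ('a \<Rightarrow>\<^sub>L 'a) \<Rightarrow> ('b \<Rightarrow>\<^sub>L 'b) \<Rightarrow> ('k \<Rightarrow>\<^sub>L 'k)"
  where "op_tensor t a b = (THE T. T \<in> bounded_ops \<and>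
    (\<forall>x y. blinfun_apply T (t x y) = t (blinfun_apply a x) (blinfun_apply b y)))"

text \<open>The von Neumann algebra tensor product is the ultraweak closure of the algebraic one.
  For complex subspaces \<open>M\<close>, the real \<open>span\<close> below is the complex span.\<close>

definition vn_tensor ::
  "('a::chilbert_space \<Rightarrow> 'b::chilbert_space \<Rightarrow> 'k::chilbert_space)
    \<Rightarrow> ('a \<Rightarrow>\<^sub>L 'a) set \<Rightarrow> ('b \<Rightarrow>\<^sub>L 'b) set \<Rightarrow> ('k \<Rightarrow>\<^sub>L 'k) set"
  where "vn_tensor t M N = ultraweak closure_of (span {op_tensor t a b | a b. a \<in> M \<and> b \<in> N})"

text \<open>The next three maps are determined on \<open>vn_tensor t M M\<close> by their values on simple
  tensors, linearity and ultraweak continuity. Outside of that set they are made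
  \<open>undefined\<close> by \<open>extensional\<close>, so that the descriptions are unique.\<close>

definition flip_map ::
  "('a::chilbert_space \<Rightarrow> 'a \<Rightarrow> 'k::chilbert_space) \<Rightarrow> ('a \<Rightarrow>\<^sub>L 'a) set
    \<Rightarrow> ('k \<Rightarrow>\<^sub>L 'k) \<Rightarrow> ('k \<Rightarrow>\<^sub>L 'k)"
  where "flip_map t M = (THE U. U \<in> vn_tensor t M M \<rightarrow>\<^sub>E vn_tensor t M M \<and>
    clinear_on (vn_tensor t M M) U \<and>
    ultraweakly_continuous_map (vn_tensor t M M) (vn_tensor t M M) U \<and>
    (\<forall>x\<in>M. \<forall>y\<in>M. U (op_tensor t x y) = op_tensor t y x))"

definition slice_map ::
  "('a::chilbert_space \<Rightarrow> 'a \<Rightarrow> 'k::chilbert_space) \<Rightarrow> ('a \<Rightarrow>\<^sub>L 'a) set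
    \<Rightarrow> (('a \<Rightarrow>\<^sub>L 'a) \<Rightarrow> complex) \<Rightarrow> ('k \<Rightarrow>\<^sub>L 'k) \<Rightarrow> ('a \<Rightarrow>\<^sub>L 'a)"
  where "slice_map t M \<phi> = (THE E. E \<in> vn_tensor t M M \<rightarrow>\<^sub>E M \<and>
    clinear_on (vn_tensor t M M) E \<and>
    ultraweakly_continuous_map (vn_tensor t M M) M E \<and>
    (\<forall>a\<in>M. \<forall>b\<in>M. E (op_tensor t a b) = \<phi> b *\<^sub>C a))"

definition functional_tensor ::
  "('a::chilbert_space \<Rightarrow> 'a \<Rightarrow> 'k::chilbert_space) \<Rightarrow> ('a \<Rightarrow>\<^sub>L 'a) set
    \<Rightarrow> (('a \<Rightarrow>\<^sub>L 'a) \<Rightarrow> complex) \<Rightarrow> (('a \<Rightarrow>\<^sub>L 'a) \<Rightarrow> complex) \<Rightarrow> ('k \<Rightarrow>\<^sub>L 'k) \<Rightarrow> complex"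
  where "functional_tensor t M \<phi> \<psi> = (THE f. f \<in> extensional (vn_tensor t M M) \<and>
    clinear_on (vn_tensor t M M) f \<and>
    ultraweakly_continuous_functional (vn_tensor t M M) f \<and>
    (\<forall>a\<in>M. \<forall>b\<in>M. f (op_tensor t a b) = \<phi> a * \<psi> b))"


section \<open>Markov processes and quantum quadratic stochastic processes\<close>

text \<open>Families indexed by \<open>s, t \<in> \<real>\<^sub>+\<close> with \<open>t - s \<ge> 1\<close> are total functions of
  two reals; values at other indices are irrelevant. Nonnegativity of the later times follows
  from that of \<open>s\<close>.\<close>

definition markov_process ::
  "('a::chilbert_space \<Rightarrow>\<^sub>L 'a) set \<Rightarrow> (real \<Rightarrow> real \<Rightarrow> ('a \<Rightarrow>\<^sub>L 'a) \<Rightarrow> ('a \<Rightarrow>\<^sub>L 'a)) \<Rightarrow> bool"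
  where "markov_process N T \<longleftrightarrow>
    (\<forall>s t. s \<ge> 0 \<longrightarrow> t - s \<ge> 1 \<longrightarrow> normal_ucp_map N N (T s t)) \<and>
    (\<forall>s \<tau> t. s \<ge> 0 \<longrightarrow> \<tau> - s \<ge> 1 \<longrightarrow> t - \<tau> \<ge> 1 \<longrightarrow> (\<forall>x\<in>N. T s t x = T s \<tau> (T \<tau> t x)))"

definition qqsp_type_A ::
  "('a::chilbert_space \<Rightarrow> 'a \<Rightarrow> 'k::chilbert_space) \<Rightarrow> ('a \<Rightarrow>\<^sub>L 'a) set
    \<Rightarrow> (real \<Rightarrow> real \<Rightarrow> ('a \<Rightarrow>\<^sub>L 'a) \<Rightarrow> ('k \<Rightarrow>\<^sub>L 'k)) \<Rightarrow> (('a \<Rightarrow>\<^sub>L 'a) \<Rightarrow> complex) \<Rightarrow> bool"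
  where "qqsp_type_A t\<^sub>H M P \<omega>\<^sub>0 \<longleftrightarrow>
    normal_state M \<omega>\<^sub>0 \<and>
    (\<forall>s t. s \<ge> 0 \<longrightarrow> t - s \<ge> 1 \<longrightarrow>
      normal_ucp_map M (vn_tensor t\<^sub>H M M) (P s t) \<and>
      (\<forall>x\<in>M. flip_map t\<^sub>H M (P s t x) = P s t x)) \<and>
    (\<forall>s \<tau> t. s \<ge> 0 \<longrightarrow> \<tau> - s \<ge> 1 \<longrightarrow> t - \<tau> \<ge> 1 \<longrightarrow>
      (let \<omega>\<^sub>\<tau> = (\<lambda>y. functional_tensor t\<^sub>H M \<omega>\<^sub>0 \<omega>\<^sub>0 (P 0 \<tau> y))
       in \<forall>x\<in>M. P s t x = P s \<tau> (slice_map t\<^sub>H M \<omega>\<^sub>\<tau> (P \<tau> t x))))"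

end

theory Submission
  imports Defs
begin

text \<open>
  The algebra behind the theorem is short.  Write \<open>x \<otimes> 1\<close> for the amplification of \<open>x\<close>.
  Since \<open>\<phi> t\<close> is normalised, the slice \<open>E\<close> for \<open>\<phi> t\<close> maps \<open>x \<otimes> 1\<close> to \<open>x\<close>, so hypothesis
  \<open>ii\<close> at \<open>x \<otimes> 1\<close> reads \<open>E\<^bsub>\<psi> s\<^esub> (P s t x) = Q s t x\<close>.  For \<open>s = 0\<close>, where \<open>\<psi> 0 = \<omega>\<^sub>0\<close>, applying \<open>\<omega>\<^sub>0\<close> on
  both sides and using \<open>\<omega>\<^sub>0 \<otimes> \<omega>\<^sub>0 = \<omega>\<^sub>0 \<circ> E\<^bsub>\<omega>\<^sub>0\<^esub>\<close> yields \<open>\<psi> t = \<phi> t\<close>; the same equation for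
  general \<open>s\<close> then recovers \<open>Q\<close> from \<open>P\<close>.  The Markov property of \<open>H\<close> at \<open>x \<otimes> 1\<close> says
  \<open>P s t x = H s \<tau> (P \<tau> t x)\<close>, and hypothesis \<open>iii\<close> at \<open>P \<tau> t x\<close> turns this into the quadratic
  Chapman-Kolmogorov equation.  Invariance of \<open>P s t x\<close> under the flip is hypothesis \<open>i\<close>
  at \<open>x \<otimes> 1\<close>.

  The work lies in showing that the objects have the properties used above.  Slice maps and
  product functionals are defined by descriptions, so their existence and uniqueness must be proved;
  and \<open>P s t\<close> must inherit normality and complete positivity from \<open>H s t\<close>, which requires
  these properties of the amplification.  Three ideas carry this.

  \<^item> An orthonormal basis of the second factor decomposes the Hilbert space tensor product into an
    orthogonal sum of copies of the first factor (\<open>leg_expansion\<close>).  An operator \<open>a \<otimes> 1\<close> acts in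
    each copy separately.  This gives the existence of \<open>a \<otimes> b\<close>
    (\<open>amplification_exists\<close>, \<open>op_tensor_bounded_ops\<close>), the ultraweak continuity of the
    amplification (\<open>continuous_map_amplification\<close>) and its complete positivity
    (\<open>completely_positive_on_amplification\<close>).

  \<^item> A series of vector functionals may be indexed by an arbitrary set
    (\<open>ultraweak_functionalI\<close>).  Composing such a series with an amplification or with a slice gives a
    double series of the same kind, which is how ultraweak continuity is proved throughout.

  \<^item> An ultraweakly continuous functional on a subspace of operators is the restriction of a series of
    vector functionals (\<open>ultraweakly_continuous_functional_extends\<close>).  The slice map of a normal
    functional is therefore an explicit series of operators, and it maps into \<open>M\<close> because von
    Neumann algebras are ultraweakly closed (\<open>slice_map_is_slice\<close>).
\<close>

section \<open>Complex inner product spaces\<close>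

instance chilbert_space \<subseteq> banach ..

lemma cinner_scaleR_right: "cinner x (r *\<^sub>R y) = r *\<^sub>R cinner x y"
  for x y :: "'a::complex_inner"
  by (metis cinner_scaleC_right scaleC_of_real scaleR_conv_of_real)

lemma cinner_add_left: "cinner (x + y) z = cinner x z + cinner y z"
  for x y z :: "'a::complex_inner"
  by (metis cinner_add_right cinner_commute complex_cnj_add)

lemma cinner_scaleR_left: "cinner (r *\<^sub>R x) y = r *\<^sub>R cinner x y"
  for x y :: "'a::complex_inner"
  by (metis cinner_scaleC_left complex_cnj_complex_of_real scaleC_of_real scaleR_conv_of_real)

lemma norm_cinner_le: "cmod (cinner x y) \<le> norm x * norm y"
  for x y :: "'a::complex_inner"
proof (cases "cinner x y = 0")
  case False
  \<comment> \<open>The phase \<open>d\<close> makes the inner product real, where the real inequality applies.\<close>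
  define d where "d = cinner x y / cmod (cinner x y)"
  have d: "cmod d = 1"
    using False by (simp add: d_def norm_divide)
  have "cinner (d *\<^sub>C x) y = complex_of_real (cmod (cinner x y))"
    using False complex_norm_square[of "cinner x y"]
    by (simp add: cinner_scaleC_left d_def field_simps power2_eq_square)
  then have "cmod (cinner x y) = inner (d *\<^sub>C x) y"
    by (simp add: inner_eq_Re_cinner)
  also have "\<dots> \<le> norm (d *\<^sub>C x) * norm y"
    by (rule norm_cauchy_schwarz)
  finally show ?thesis
    by (simp add: norm_scaleC d)
qed auto

interpretation cinner: bounded_bilinear "cinner :: 'a::complex_inner \<Rightarrow> 'a \<Rightarrow> complex"
  by unfold_locales
    (auto intro!: exI[of _ 1] simp: cinner_add_left cinner_add_right cinner_scaleR_left
      cinner_scaleR_right norm_cinner_le)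

declare cinner.zero_left [simp] cinner.zero_right [simp]

lemma cinner_self: "cinner x x = complex_of_real ((norm x)\<^sup>2)"
  for x :: "'a::complex_inner"
proof (rule complex_eqI)
  show "Re (cinner x x) = Re (complex_of_real ((norm x)\<^sup>2))"
    using power2_norm_eq_inner[of x] by (simp add: inner_eq_Re_cinner del: of_real_power)
  show "Im (cinner x x) = Im (complex_of_real ((norm x)\<^sup>2))"
    using arg_cong[OF cinner_commute[of x x], of Im] by (simp del: of_real_power)
qed

lemma norm_cinner_self: "cmod (cinner x x) = (norm x)\<^sup>2" for x :: "'a::complex_inner"
  unfolding cinner_self norm_of_real by simp

lemma cinner_ext: "(\<And>z. cinner z x = cinner z y) \<Longrightarrow> x = y"
  for x y :: "'a::complex_inner"
  using cinner_self[of "x - y"] by (simp add: cinner.diff_right)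

lemma cinner_ext_left: "(\<And>z. cinner x z = cinner y z) \<Longrightarrow> x = y"
  for x y :: "'a::complex_inner"
  by (rule cinner_ext) (metis cinner_commute)

lemma scaleC_one [simp]: "1 *\<^sub>C x = x" for x :: "'a::complex_vector"
  using scaleC_of_real[of 1 x] by simp

lemma scaleC_zero_left [simp]: "0 *\<^sub>C x = 0" for x :: "'a::complex_vector"
  using scaleC_of_real[of 0 x] by simp

lemma scaleC_zero_right [simp]: "c *\<^sub>C 0 = 0" for c and x :: "'a::complex_vector"
  by (metis scaleC_add_right add_cancel_right_left)

lemma nonneg_Reals_iff_le: "z \<in> \<real>\<^sub>\<ge>\<^sub>0 \<longleftrightarrow> (0::complex) \<le> z"
  by (simp add: complex_nonneg_Reals_iff less_eq_complex_def)

section \<open>Orthogonal series and orthonormal bases\<close>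

lemma norm_sum_orthogonal:
  assumes "finite F" "F \<subseteq> I" "pairwise (\<lambda>i j. inner (w i) (w j) = 0) I"
  shows "(norm (sum w F))\<^sup>2 = (\<Sum>i\<in>F. (norm (w i))\<^sup>2)"
  using norm_sum_Pythagorean[of F w] assms
  by (auto simp: pairwise_def orthogonal_def subset_iff)

text \<open>By the theorem of Pythagoras the partial sums of an orthogonal family satisfy the same
  Cauchy condition as the partial sums of the squared norms.\<close>

lemma orthogonal_summable_on:
  fixes w :: "'i \<Rightarrow> 'a::{real_inner,banach}"
  assumes orth: "pairwise (\<lambda>i j. inner (w i) (w j) = 0) I"
    and sq: "(\<lambda>i. (norm (w i))\<^sup>2) summable_on I"
  shows "w summable_on I"
proof -
  define L where "L = infsum (\<lambda>i. (norm (w i))\<^sup>2) I"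
  have le_L: "(\<Sum>i\<in>F. (norm (w i))\<^sup>2) \<le> L" if "finite F" "F \<subseteq> I" for F
    unfolding L_def using that sq by (intro finite_sum_le_infsum) auto
  have "\<exists>P. eventually P (finite_subsets_at_top I) \<and>
      (\<forall>F F'. P F \<and> P F' \<longrightarrow> dist (sum w F) (sum w F') < e)" if "e > 0" for e
  proof -
    define d where "d = (e/3)\<^sup>2"
    have "d > 0"
      using that by (simp add: d_def)
    obtain G where G: "finite G" "G \<subseteq> I" "dist (\<Sum>i\<in>G. (norm (w i))\<^sup>2) L \<le> d"
      using infsum_finite_approximation[OF sq \<open>d > 0\<close>] unfolding L_def by blast
    have tail: "norm (sum w F - sum w G) \<le> e/3" if F: "finite F" "F \<subseteq> I" "G \<subseteq> F" for F
    proof -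
      have "(norm (sum w F - sum w G))\<^sup>2 = (norm (sum w (F - G)))\<^sup>2"
        using F by (simp add: sum_diff)
      also have "\<dots> = (\<Sum>i\<in>F - G. (norm (w i))\<^sup>2)"
        using F by (intro norm_sum_orthogonal[OF _ _ orth]) auto
      also have "\<dots> = (\<Sum>i\<in>F. (norm (w i))\<^sup>2) - (\<Sum>i\<in>G. (norm (w i))\<^sup>2)"
        using F by (simp add: sum_diff)
      also have "\<dots> \<le> d"
        using le_L[OF F(1,2)] G(3) by (auto simp: dist_real_def)
      finally show ?thesis
        using \<open>e > 0\<close> unfolding d_def by (simp add: power2_le_iff_abs_le)
    qed
    show ?thesis
    proof (intro exI conjI allI impI)
      show "eventually (\<lambda>F. finite F \<and> F \<subseteq> I \<and> G \<subseteq> F) (finite_subsets_at_top I)"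
        unfolding eventually_finite_subsets_at_top using G by blast
      fix F F' assume *: "(finite F \<and> F \<subseteq> I \<and> G \<subseteq> F) \<and> finite F' \<and> F' \<subseteq> I \<and> G \<subseteq> F'"
      have "dist (sum w F) (sum w F') \<le> norm (sum w F - sum w G) + norm (sum w F' - sum w G)"
        by (metis dist_norm dist_triangle2)
      also have "\<dots> \<le> e/3 + e/3"
        using * by (intro add_mono tail) auto
      also have "\<dots> < e"
        using that by simp
      finally show "dist (sum w F) (sum w F') < e" .
    qed
  qed
  then have "cauchy_filter (filtermap (sum w) (finite_subsets_at_top I))"
    by (simp add: cauchy_filter_metric_filtermap)
  moreover have "complete (UNIV::'a set)"
    by (meson Cauchy_convergent UNIV_I complete_def convergent_def)
  ultimately obtain L' where "(sum w \<longlongrightarrow> L') (finite_subsets_at_top I)"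
    using complete_uniform[where S = UNIV] by (force simp add: filterlim_def)
  then show ?thesis
    using summable_on_def has_sum_def by blast
qed

lemma orthogonal_norm_infsum:
  fixes w :: "'i \<Rightarrow> 'a::{real_inner,banach}"
  assumes orth: "pairwise (\<lambda>i j. inner (w i) (w j) = 0) I" and w: "w summable_on I"
  shows "((\<lambda>i. (norm (w i))\<^sup>2) has_sum (norm (infsum w I))\<^sup>2) I"
proof -
  have "((\<lambda>F. (norm (sum w F))\<^sup>2) \<longlongrightarrow> (norm (infsum w I))\<^sup>2) (finite_subsets_at_top I)"
    using w by (intro tendsto_intros) (auto simp: has_sum_def[symmetric])
  moreover have "eventually (\<lambda>F. (norm (sum w F))\<^sup>2 = (\<Sum>i\<in>F. (norm (w i))\<^sup>2)) (finite_subsets_at_top I)"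
    by (rule eventually_finite_subsets_at_top_weakI) (rule norm_sum_orthogonal[OF _ _ orth])
  ultimately show ?thesis
    unfolding has_sum_def by (rule Lim_transform_eventually)
qed

text \<open>Bessel's inequality, for the orthogonal projections \<open>w i\<close> of a vector \<open>x\<close> to pairwise
  orthogonal subspaces.\<close>

lemma bessel:
  fixes w :: "'i \<Rightarrow> 'a::{real_inner,banach}"
  assumes orth: "pairwise (\<lambda>i j. inner (w i) (w j) = 0) I"
    and proj: "\<And>i. i \<in> I \<Longrightarrow> inner (w i) x = (norm (w i))\<^sup>2"
  shows "(\<lambda>i. (norm (w i))\<^sup>2) summable_on I" "w summable_on I"
    "infsum (\<lambda>i. (norm (w i))\<^sup>2) I \<le> (norm x)\<^sup>2"
proof -
  have le: "(\<Sum>i\<in>F. (norm (w i))\<^sup>2) \<le> (norm x)\<^sup>2" if F: "finite F" "F \<subseteq> I" for F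
  proof -
    have *: "(norm (sum w F))\<^sup>2 = (\<Sum>i\<in>F. (norm (w i))\<^sup>2)"
      by (rule norm_sum_orthogonal[OF F orth])
    also have "\<dots> = inner (sum w F) x"
      using F proj by (auto simp: inner_sum_left subset_iff intro!: sum.cong)
    also have "\<dots> \<le> norm (sum w F) * norm x"
      by (rule norm_cauchy_schwarz)
    finally have "norm (sum w F) \<le> norm x"
      by (cases "norm (sum w F) = 0") (auto simp: power2_eq_square)
    then show ?thesis
      using * by (metis norm_ge_zero power_mono)
  qed
  show sq: "(\<lambda>i. (norm (w i))\<^sup>2) summable_on I"
    by (rule nonneg_bdd_above_summable_on) (auto intro!: bdd_aboveI[of _ "(norm x)\<^sup>2"] le)
  show "w summable_on I"
    by (rule orthogonal_summable_on[OF orth sq])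
  show "infsum (\<lambda>i. (norm (w i))\<^sup>2) I \<le> (norm x)\<^sup>2"
    by (rule infsum_le_finite_sums[OF sq le])
qed

text \<open>Completeness is expressed by maximality, the form that Zorn's lemma provides and that the
  totality arguments use; the convergence of expansions is a consequence.\<close>

definition orthonormal_basis :: "'a::complex_inner set \<Rightarrow> bool"
  where "orthonormal_basis B \<longleftrightarrow>
    (\<forall>e\<in>B. norm e = 1) \<and> pairwise (\<lambda>e f. cinner e f = 0) B \<and>
    (\<forall>v. (\<forall>e\<in>B. cinner e v = 0) \<longrightarrow> v = 0)"

lemma orthonormal_basisD:
  assumes "orthonormal_basis B"
  shows "e \<in> B \<Longrightarrow> f \<in> B \<Longrightarrow> cinner e f = (if e = f then 1 else 0)"
    "(\<And>e. e \<in> B \<Longrightarrow> cinner e v = 0) \<Longrightarrow> v = 0"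
  using assms unfolding orthonormal_basis_def pairwise_def by (auto simp: cinner_self)

text \<open>A vector orthogonal to a maximal orthonormal set could be normalised and added to it.\<close>

lemma orthonormal_basis_exists: "\<exists>B :: 'a::complex_inner set. orthonormal_basis B"
proof -
  define A where
    "A = {B :: 'a set. (\<forall>e\<in>B. norm e = 1) \<and> pairwise (\<lambda>e f. cinner e f = 0) B}"
  have "\<exists>B\<in>A. \<forall>X\<in>A. B \<subseteq> X \<longrightarrow> X = B"
  proof (rule subset_Zorn')
    fix C assume C: "subset.chain A C"
    then have "chain\<^sub>\<subseteq> C"
      by (auto simp: subset.chain_def chain_subset_def)
    then have "pairwise (\<lambda>e f. cinner e f = 0) (\<Union>C)"
      using C by (intro pairwise_chain_Union) (auto simp: A_def subset.chain_def)
    then show "\<Union>C \<in> A"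
      using C by (auto simp: A_def subset.chain_def)
  qed
  then obtain B where B: "B \<in> A" and max: "\<And>X. X \<in> A \<Longrightarrow> B \<subseteq> X \<Longrightarrow> X = B"
    by blast
  have "v = 0" if v: "\<forall>e\<in>B. cinner e v = 0" for v
  proof (rule ccontr)
    assume "v \<noteq> 0"
    define u where "u = (1 / norm v) *\<^sub>R v"
    have u: "norm u = 1" "\<forall>e\<in>B. cinner e u = 0"
      using \<open>v \<noteq> 0\<close> v by (auto simp: u_def cinner.scaleR_right)
    then have "\<forall>e\<in>B. cinner u e = 0"
      by (metis cinner_commute complex_cnj_zero)
    then have "insert u B \<in> A"
      using B u by (auto simp: A_def pairwise_insert)
    then have "u \<in> B"
      using max by blast
    then show False
      using u by (metis cinner_self norm_one of_real_1 one_neq_zero power_one)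
  qed
  then show ?thesis
    using B unfolding A_def orthonormal_basis_def by blast
qed

text \<open>The series converges by Bessel's inequality, and the difference between \<open>v\<close> and its sum is
  orthogonal to \<open>B\<close>.\<close>

lemma orthonormal_expansion:
  fixes v :: "'a::chilbert_space"
  assumes B: "orthonormal_basis B"
  shows "((\<lambda>e. cinner e v *\<^sub>C e) has_sum v) B"
proof -
  define w where "w = (\<lambda>e. cinner e v *\<^sub>C e)"
  have norm_w: "norm (w e) = cmod (cinner e v)" if "e \<in> B" for e
    using B that by (simp add: w_def norm_scaleC orthonormal_basis_def)
  have orth: "pairwise (\<lambda>i j. inner (w i) (w j) = 0) B"
    by (auto simp: w_def pairwise_def inner_eq_Re_cinner cinner_scaleC_left cinner_scaleC_right
      orthonormal_basisD[OF B])
  have "inner (w e) v = (norm (w e))\<^sup>2" if "e \<in> B" for e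
    using that
    unfolding norm_w[OF that]
    by (simp add: w_def inner_eq_Re_cinner cinner_scaleC_left cmod_power2) (simp add: power2_eq_square)
  then have w: "w summable_on B"
    by (intro bessel(2)[OF orth])
  have "cinner f (v - infsum w B) = 0" if f: "f \<in> B" for f
  proof -
    have "((\<lambda>e. cinner f (w e)) has_sum cinner f (infsum w B)) B"
      by (rule has_sum_bounded_linear[OF cinner.bounded_linear_right]) (simp add: w)
    moreover have "((\<lambda>e. cinner f (w e)) has_sum cinner f v) B"
      using f
      by (intro has_sum_finite_neutralI[where B = "{f}"])
        (auto simp: w_def cinner_scaleC_right orthonormal_basisD[OF B])
    ultimately show ?thesis
      using has_sum_unique by (auto simp: cinner.diff_right)
  qed
  then have "v - infsum w B = 0"
    by (rule orthonormal_basisD(2)[OF B])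
  then have "(w has_sum v) B"
    using has_sum_infsum[OF w] by simp
  then show ?thesis
    by (simp only: w_def)
qed

section \<open>Adjoints\<close>

text \<open>The expansion of \<open>x\<close> in an orthonormal basis forces the representing vector to be
  \<open>\<Sum>e. cnj (f e) e\<close>; boundedness of \<open>f\<close> makes this orthogonal series converge.\<close>

lemma riesz_representation:
  fixes f :: "'a::chilbert_space \<Rightarrow> complex"
  assumes f: "bounded_linear f" and fC: "\<And>c x. f (c *\<^sub>C x) = c * f x"
  shows "\<exists>y. \<forall>x. f x = cinner y x"
proof -
  interpret bounded_linear f by (rule f)
  obtain B :: "'a set" where B: "orthonormal_basis B"
    using orthonormal_basis_exists by blast
  define w where "w = (\<lambda>e. cnj (f e) *\<^sub>C e)"
  have norm_w: "norm (w e) = cmod (f e)" if "e \<in> B" for e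
    using B that by (simp add: w_def norm_scaleC orthonormal_basis_def)
  have orth: "pairwise (\<lambda>i j. inner (w i) (w j) = 0) B"
    by (auto simp: w_def pairwise_def inner_eq_Re_cinner cinner_scaleC_left cinner_scaleC_right
      orthonormal_basisD[OF B])
  obtain K where K: "\<And>x. cmod (f x) \<le> norm x * K" "K \<ge> 0"
    using nonneg_bounded by auto
  have le: "(\<Sum>e\<in>F. (norm (w e))\<^sup>2) \<le> K\<^sup>2" if F: "finite F" "F \<subseteq> B" for F
  proof -
    \<comment> \<open>The functional attains the sum of the squares at the partial sum itself.\<close>
    have *: "(norm (sum w F))\<^sup>2 = (\<Sum>e\<in>F. (norm (w e))\<^sup>2)"
      by (rule norm_sum_orthogonal[OF F orth])
    have "f (w e) = complex_of_real ((norm (w e))\<^sup>2)" if "e \<in> B" for e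
      unfolding norm_w[OF that] complex_norm_square by (simp add: w_def fC mult.commute)
    then have "f (sum w F) = (\<Sum>e\<in>F. complex_of_real ((norm (w e))\<^sup>2))"
      unfolding sum using F by (intro sum.cong) (auto simp: subset_iff simp del: of_real_power)
    then have "cmod (f (sum w F)) = (norm (sum w F))\<^sup>2"
      unfolding * of_real_sum[symmetric] by (simp only: norm_of_real) (simp add: sum_nonneg)
    then have "(norm (sum w F))\<^sup>2 \<le> norm (sum w F) * K"
      using K(1)[of "sum w F"] by simp
    then have "norm (sum w F) \<le> K"
      using K(2) by (cases "norm (sum w F) = 0") (auto simp: power2_eq_square)
    then show ?thesis
      using * by (metis norm_ge_zero power_mono)
  qed
  have "(\<lambda>e. (norm (w e))\<^sup>2) summable_on B"
    by (rule nonneg_bdd_above_summable_on) (auto intro!: bdd_aboveI[of _ "K\<^sup>2"] le)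
  then have w: "w summable_on B"
    by (rule orthogonal_summable_on[OF orth])
  have "f x = cinner (infsum w B) x" for x
  proof -
    have "((\<lambda>e. f (cinner e x *\<^sub>C e)) has_sum f x) B"
      by (rule has_sum_bounded_linear[OF f orthonormal_expansion[OF B]])
    moreover have "((\<lambda>e. cinner (w e) x) has_sum cinner (infsum w B) x) B"
      using has_sum_bounded_linear[OF cinner.bounded_linear_left] w by (metis has_sum_infsum)
    moreover have "f (cinner e x *\<^sub>C e) = cinner (w e) x" for e
      by (simp add: fC w_def cinner_scaleC_left)
    ultimately show ?thesis
      using has_sum_unique by auto
  qed
  then show ?thesis
    by blast
qed

text \<open>The counterpart of \<^const>\<open>bounded_ops\<close> for operators between different spaces, such as the
  isometries \<open>u \<mapsto> u \<otimes> v\<close> into a tensor product.\<close>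

definition complex_linear :: "('a::complex_inner \<Rightarrow>\<^sub>L 'b::complex_inner) \<Rightarrow> bool"
  where "complex_linear T \<longleftrightarrow> (\<forall>c x. blinfun_apply T (c *\<^sub>C x) = c *\<^sub>C blinfun_apply T x)"

lemma complex_linearD: "complex_linear T \<Longrightarrow> blinfun_apply T (c *\<^sub>C x) = c *\<^sub>C blinfun_apply T x"
  by (simp add: complex_linear_def)

lemma bounded_ops_iff: "T \<in> bounded_ops \<longleftrightarrow> complex_linear T"
  by (simp add: bounded_ops_def complex_linear_def)

definition adj :: "('a::chilbert_space \<Rightarrow>\<^sub>L 'b::chilbert_space) \<Rightarrow> ('b \<Rightarrow>\<^sub>L 'a)"
  where "adj T = (SOME S. \<forall>x y. cinner (blinfun_apply S x) y = cinner x (blinfun_apply T y))"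

lemma cinner_adj:
  assumes T: "complex_linear T"
  shows "cinner (blinfun_apply (adj T) x) y = cinner x (blinfun_apply T y)"
proof -
  have "\<exists>z. \<forall>y. cinner x (blinfun_apply T y) = cinner z y" for x
    by (rule riesz_representation)
      (auto simp: complex_linearD[OF T] cinner_scaleC_right
        intro!: bounded_linear_compose[OF cinner.bounded_linear_right blinfun.bounded_linear_right])
  then obtain S where S: "\<And>x y. cinner (S x) y = cinner x (blinfun_apply T y)"
    by metis
  have "bounded_linear S"
  proof (rule bounded_linear_intro[where K = "norm T"])
    show "S (x + y) = S x + S y" "S (r *\<^sub>R x) = r *\<^sub>R S x" for x y r
      by (rule cinner_ext_left; simp add: S cinner.add_left cinner.scaleR_left)+
    show "norm (S x) \<le> norm x * norm T" for x
    proof -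
      have "(norm (S x))\<^sup>2 = cmod (cinner x (blinfun_apply T (S x)))"
        by (simp add: S[symmetric] norm_cinner_self)
      also have "\<dots> \<le> norm x * norm (blinfun_apply T (S x))"
        by (rule norm_cinner_le)
      also have "\<dots> \<le> norm x * (norm T * norm (S x))"
        by (intro mult_left_mono norm_blinfun) auto
      finally show ?thesis
        by (cases "norm (S x) = 0") (auto simp: power2_eq_square)
    qed
  qed
  then have "blinfun_apply (Blinfun S) = S"
    by (rule bounded_linear_Blinfun_apply)
  then have "\<exists>S. \<forall>x y. cinner (blinfun_apply S x) y = cinner x (blinfun_apply T y)"
    using S by metis
  then show ?thesis
    unfolding adj_def by (rule someI2_ex) blast
qed

lemma cinner_adj_right:
  assumes T: "complex_linear T"
  shows "cinner x (blinfun_apply (adj T) y) = cinner (blinfun_apply T x) y"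
  by (metis cinner_adj[OF T] cinner_commute)

lemma complex_linear_adj:
  assumes T: "complex_linear T"
  shows "complex_linear (adj T)"
  unfolding complex_linear_def
  by (intro allI, rule cinner_ext_left) (simp add: cinner_adj[OF T] cinner_scaleC_left)

lemma norm_adj_le:
  assumes T: "complex_linear T"
  shows "norm (adj T) \<le> norm T"
proof (rule norm_blinfun_bound)
  fix x
  let ?S = "blinfun_apply (adj T)"
  have "(norm (?S x))\<^sup>2 = cmod (cinner x (blinfun_apply T (?S x)))"
    by (simp add: cinner_adj[OF T, symmetric] norm_cinner_self)
  also have "\<dots> \<le> norm x * norm (blinfun_apply T (?S x))"
    by (rule norm_cinner_le)
  also have "\<dots> \<le> norm x * (norm T * norm (?S x))"
    by (intro mult_left_mono norm_blinfun) auto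
  finally show "norm (?S x) \<le> norm T * norm x"
    by (cases "norm (?S x) = 0") (auto simp: power2_eq_square mult.commute)
qed auto

section \<open>Ultraweakly continuous functionals\<close>

abbreviation square_summable_on :: "('i \<Rightarrow> 'a::real_normed_vector) \<Rightarrow> 'i set \<Rightarrow> bool"
  (infix "square'_summable'_on" 50)
  where "x square_summable_on I \<equiv> (\<lambda>i. (norm (x i))\<^sup>2) summable_on I"

lemma mult_le_sum_power2: "a * b \<le> a\<^sup>2 + b\<^sup>2" if "0 \<le> a" "0 \<le> b" for a b :: real
  using sum_squares_bound[of a b] mult_nonneg_nonneg[OF that] by linarith

lemma cinner_abs_summable_on:
  fixes T :: "'a::complex_inner \<Rightarrow>\<^sub>L 'b::complex_inner"
  assumes "\<xi> square_summable_on I" "\<eta> square_summable_on I"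
  shows "(\<lambda>i. cmod (cinner (\<eta> i) (blinfun_apply T (\<xi> i)))) summable_on I"
proof (rule summable_on_comparison_test)
  show "(\<lambda>i. norm T * ((norm (\<eta> i))\<^sup>2 + (norm (\<xi> i))\<^sup>2)) summable_on I"
    by (intro summable_on_cmult_right summable_on_add assms)
  show "cmod (cinner (\<eta> i) (blinfun_apply T (\<xi> i))) \<le> norm T * ((norm (\<eta> i))\<^sup>2 + (norm (\<xi> i))\<^sup>2)" for i
  proof -
    have "cmod (cinner (\<eta> i) (blinfun_apply T (\<xi> i))) \<le> norm (\<eta> i) * norm (blinfun_apply T (\<xi> i))"
      by (rule norm_cinner_le)
    also have "\<dots> \<le> norm (\<eta> i) * (norm T * norm (\<xi> i))"
      by (intro mult_left_mono norm_blinfun) auto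
    also have "\<dots> = norm T * (norm (\<eta> i) * norm (\<xi> i))"
      by simp
    also have "\<dots> \<le> norm T * ((norm (\<eta> i))\<^sup>2 + (norm (\<xi> i))\<^sup>2)"
      by (intro mult_left_mono mult_le_sum_power2) auto
    finally show ?thesis .
  qed
qed auto

lemmas cinner_summable_on = abs_summable_summable[OF cinner_abs_summable_on]

text \<open>Sequences may be replaced by families over any index set, because a square-summable
  family has countable support.  This makes double series and series over an
  uncountable orthonormal basis available as ultraweakly continuous functionals.\<close>

lemma ultraweak_functionalI:
  fixes \<xi> \<eta> :: "'i \<Rightarrow> 'a::chilbert_space"
  assumes \<xi>: "\<xi> square_summable_on I" and \<eta>: "\<eta> square_summable_on I"
  shows "(\<lambda>T. \<Sum>\<^sub>\<infinity>i\<in>I. cinner (\<eta> i) (blinfun_apply T (\<xi> i))) \<in> ultraweak_functionals"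
proof -
  define J where "J = {i \<in> I. \<xi> i \<noteq> 0}"
  define k where "k = to_nat_on J"
  have "countable J"
    using summable_countable_real[OF \<xi>] by (simp add: J_def)
  then have k: "inj_on k J" "\<And>i. i \<in> J \<Longrightarrow> from_nat_into J (k i) = i"
    by (auto simp: k_def)
  have "J \<subseteq> I"
    by (auto simp: J_def)
  define ext where "ext v n = (if n \<in> k ` J then v (from_nat_into J n) else (0::'a))" for v n
  have sq: "summable (\<lambda>n. (norm (ext v n))\<^sup>2)" if "v square_summable_on I" for v
  proof -
    have "v square_summable_on J"
      using that \<open>J \<subseteq> I\<close> by (rule summable_on_subset_banach)
    also have "?this \<longleftrightarrow> ((\<lambda>n. (norm (ext v n))\<^sup>2) \<circ> k) summable_on J"
      by (rule summable_on_cong) (simp add: ext_def k)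
    also have "\<dots> \<longleftrightarrow> ext v square_summable_on (k ` J)"
      using k(1) by (rule summable_on_reindex[symmetric])
    also have "\<dots> \<longleftrightarrow> ext v square_summable_on UNIV"
      by (rule summable_on_cong_neutral) (auto simp: ext_def)
    finally show ?thesis
      by (rule summable_on_imp_summable)
  qed
  have "(\<Sum>\<^sub>\<infinity>i\<in>I. cinner (\<eta> i) (blinfun_apply T (\<xi> i)))
      = (\<Sum>n. cinner (ext \<eta> n) (blinfun_apply T (ext \<xi> n)))" for T
  proof -
    define g where "g = (\<lambda>n. cinner (ext \<eta> n) (blinfun_apply T (ext \<xi> n)))"
    define s where "s = (\<Sum>\<^sub>\<infinity>i\<in>I. cinner (\<eta> i) (blinfun_apply T (\<xi> i)))"
    have "((\<lambda>i. cinner (\<eta> i) (blinfun_apply T (\<xi> i))) has_sum s) I"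
      unfolding s_def by (rule has_sum_infsum[OF cinner_summable_on[OF \<xi> \<eta>]])
    also have "?this \<longleftrightarrow> (g \<circ> k has_sum s) J"
      by (rule has_sum_cong_neutral) (auto simp: J_def[symmetric] g_def ext_def k, auto simp: J_def)
    also have "\<dots> \<longleftrightarrow> (g has_sum s) (k ` J)"
      using k(1) by (rule has_sum_reindex[symmetric])
    also have "\<dots> \<longleftrightarrow> (g has_sum s) UNIV"
      by (rule has_sum_cong_neutral) (auto simp: g_def ext_def)
    finally have "s = suminf g"
      by (intro sums_unique has_sum_imp_sums)
    then show ?thesis
      by (simp add: s_def g_def)
  qed
  then show ?thesis
    unfolding ultraweak_functionals_def using sq[OF \<xi>] sq[OF \<eta>] by blast
qed

lemma ultraweak_functionalE:
  fixes f :: "('a::chilbert_space \<Rightarrow>\<^sub>L 'a) \<Rightarrow> complex"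
  assumes "f \<in> ultraweak_functionals"
  obtains \<xi> \<eta> :: "nat \<Rightarrow> 'a" where "\<xi> square_summable_on UNIV" "\<eta> square_summable_on UNIV"
    "\<And>T. f T = (\<Sum>\<^sub>\<infinity>n. cinner (\<eta> n) (blinfun_apply T (\<xi> n)))"
proof -
  obtain \<xi> \<eta> :: "nat \<Rightarrow> 'a" where f: "f = (\<lambda>T. \<Sum>n. cinner (\<eta> n) (blinfun_apply T (\<xi> n)))"
    and sq: "\<xi> square_summable_on UNIV" "\<eta> square_summable_on UNIV"
    using assms unfolding ultraweak_functionals_def by (auto simp: summable_on_UNIV_nonneg_real_iff)
  have "f T = (\<Sum>\<^sub>\<infinity>n. cinner (\<eta> n) (blinfun_apply T (\<xi> n)))" for T
    using has_sum_imp_sums[OF has_sum_infsum[OF cinner_summable_on[OF sq]]] f sums_unique by metis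
  then show thesis
    using that sq by blast
qed

lemma ultraweak_functional_vector: "(\<lambda>T. cinner y (blinfun_apply T x)) \<in> ultraweak_functionals"
  using ultraweak_functionalI[of "\<lambda>_. x" "{()}" "\<lambda>_. y"] by simp

lemma ultraweak_functional_zero: "(\<lambda>_. 0) \<in> ultraweak_functionals"
  using ultraweak_functional_vector[of 0] by simp

lemma ultraweak_functional_scale:
  fixes f :: "('a::chilbert_space \<Rightarrow>\<^sub>L 'a) \<Rightarrow> complex"
  assumes "f \<in> ultraweak_functionals"
  shows "(\<lambda>T. c * f T) \<in> ultraweak_functionals"
proof -
  obtain \<xi> \<eta> :: "nat \<Rightarrow> 'a" where sq: "\<xi> square_summable_on UNIV" "\<eta> square_summable_on UNIV"
    and f: "\<And>T. f T = (\<Sum>\<^sub>\<infinity>n. cinner (\<eta> n) (blinfun_apply T (\<xi> n)))"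
    by (rule ultraweak_functionalE[OF assms]) blast
  have "(\<lambda>n. cnj c *\<^sub>C \<eta> n) square_summable_on UNIV"
    using sq(2) by (simp add: norm_scaleC power_mult_distrib summable_on_cmult_right)
  from ultraweak_functionalI[OF sq(1) this] show ?thesis
    by (simp add: f cinner_scaleC_left infsum_cmult_right')
qed

text \<open>The sum of two series is one series over the disjoint union of the index sets.\<close>

lemma ultraweak_functional_add:
  fixes f g :: "('a::chilbert_space \<Rightarrow>\<^sub>L 'a) \<Rightarrow> complex"
  assumes "f \<in> ultraweak_functionals" "g \<in> ultraweak_functionals"
  shows "(\<lambda>T. f T + g T) \<in> ultraweak_functionals"
proof -
  obtain \<xi> \<eta> :: "nat \<Rightarrow> 'a" where sq: "\<xi> square_summable_on UNIV" "\<eta> square_summable_on UNIV"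
    and f: "\<And>T. f T = (\<Sum>\<^sub>\<infinity>n. cinner (\<eta> n) (blinfun_apply T (\<xi> n)))"
    by (rule ultraweak_functionalE[OF assms(1)]) blast
  obtain \<xi>' \<eta>' :: "nat \<Rightarrow> 'a" where sq': "\<xi>' square_summable_on UNIV" "\<eta>' square_summable_on UNIV"
    and g: "\<And>T. g T = (\<Sum>\<^sub>\<infinity>n. cinner (\<eta>' n) (blinfun_apply T (\<xi>' n)))"
    by (rule ultraweak_functionalE[OF assms(2)]) blast
  have has_sum_case: "(case_sum p q has_sum a + b) UNIV"
    if "(p has_sum a) UNIV" "(q has_sum b) UNIV"
    for p q :: "nat \<Rightarrow> 'z::real_normed_vector" and a b
  proof -
    have "(case_sum p q has_sum a + b) (range Inl \<union> range Inr)"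
      using that by (intro has_sum_Un_disjoint) (auto simp: has_sum_reindex o_def)
    then show ?thesis
      by (simp add: UNIV_sum)
  qed
  have sum_sq: "case_sum u v square_summable_on UNIV"
    if "u square_summable_on UNIV" "v square_summable_on UNIV" for u v :: "nat \<Rightarrow> 'a"
  proof -
    have "(\<lambda>i. (norm (case_sum u v i))\<^sup>2) = case_sum (\<lambda>n. (norm (u n))\<^sup>2) (\<lambda>n. (norm (v n))\<^sup>2)"
      by (rule ext) (simp split: sum.split)
    then show ?thesis
      using has_sum_case[OF has_sum_infsum[OF that(1)] has_sum_infsum[OF that(2)]]
      by (auto intro: has_sum_imp_summable)
  qed
  have "f T + g T
      = (\<Sum>\<^sub>\<infinity>i. cinner (case_sum \<eta> \<eta>' i) (blinfun_apply T (case_sum \<xi> \<xi>' i)))" for T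
  proof -
    have "(\<lambda>i. cinner (case_sum \<eta> \<eta>' i) (blinfun_apply T (case_sum \<xi> \<xi>' i)))
        = case_sum (\<lambda>n. cinner (\<eta> n) (blinfun_apply T (\<xi> n)))
            (\<lambda>n. cinner (\<eta>' n) (blinfun_apply T (\<xi>' n)))"
      by (rule ext) (simp split: sum.split)
    then show ?thesis
      using has_sum_case[OF has_sum_infsum[OF cinner_summable_on[OF sq, of T]]
          has_sum_infsum[OF cinner_summable_on[OF sq', of T]]]
      by (simp add: f g infsumI)
  qed
  then show ?thesis
    using ultraweak_functionalI[OF sum_sq[OF sq(1) sq'(1)] sum_sq[OF sq(2) sq'(2)]] by simp
qed

lemma ultraweak_functional_linear:
  fixes f :: "('a::chilbert_space \<Rightarrow>\<^sub>L 'a) \<Rightarrow> complex"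
  assumes "f \<in> ultraweak_functionals"
  shows "f (S + T) = f S + f T" "f (c *\<^sub>C T) = c * f T"
proof -
  obtain \<xi> \<eta> :: "nat \<Rightarrow> 'a" where sq: "\<xi> square_summable_on UNIV" "\<eta> square_summable_on UNIV"
    and f: "\<And>T. f T = (\<Sum>\<^sub>\<infinity>n. cinner (\<eta> n) (blinfun_apply T (\<xi> n)))"
    by (rule ultraweak_functionalE[OF assms]) blast
  show "f (S + T) = f S + f T"
    by (simp add: f blinfun.add_left cinner.add_right infsum_add cinner_summable_on[OF sq])
  show "f (c *\<^sub>C T) = c * f T"
    by (simp add: f scaleC_blinfun_apply cinner_scaleC_right infsum_cmult_right')
qed

section \<open>The ultraweak topology\<close>

lemma ultraweak_subbasis_UNIV:
  "\<Union>{f -` V | f V. f \<in> ultraweak_functionals \<and> open V} = (UNIV :: ('a::chilbert_space \<Rightarrow>\<^sub>L 'a) set)"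
  using ultraweak_functional_zero open_UNIV by blast

lemma topspace_ultraweak [simp]: "topspace ultraweak = bounded_ops"
  unfolding ultraweak_def topspace_subtopology topology_generated_by_topspace
    ultraweak_subbasis_UNIV by simp

lemma continuous_map_ultraweak_functional:
  assumes "f \<in> ultraweak_functionals"
  shows "continuous_map ultraweak euclidean f"
  unfolding ultraweak_def
proof (rule continuous_map_from_subtopology)
  let ?S = "{f -` V | f V. f \<in> ultraweak_functionals \<and> open V} :: ('a \<Rightarrow>\<^sub>L 'a) set set"
  have "openin (topology_generated_by ?S) (f -` V)" if "open V" for V
    using assms that by (intro topology_generated_by_Basis) blast
  then show "continuous_map (topology_generated_by ?S) euclidean f"
    unfolding continuous_map_alt topology_generated_by_topspace ultraweak_subbasis_UNIV
    by simp
qed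

lemma continuous_map_ultraweakI:
  assumes "\<And>x. x \<in> topspace X \<Longrightarrow> T x \<in> bounded_ops"
    and "\<And>f. f \<in> ultraweak_functionals \<Longrightarrow> continuous_map X euclidean (\<lambda>x. f (T x))"
  shows "continuous_map X ultraweak T"
  unfolding ultraweak_def
proof (rule continuous_map_into_subtopology)
  show "continuous_map X (topology_generated_by {f -` V | f V. f \<in> ultraweak_functionals \<and> open V}) T"
  proof (rule continuous_on_generated_topo)
    fix U :: "('b \<Rightarrow>\<^sub>L 'b) set"
    assume "U \<in> {f -` V | f V. f \<in> ultraweak_functionals \<and> open V}"
    then obtain f V where U: "U = f -` V" "f \<in> ultraweak_functionals" "open V"
      by blast
    have "openin X {x \<in> topspace X. f (T x) \<in> V}"
      using assms(2)[OF U(2)] U(3) by (intro openin_continuous_map_preimage) auto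
    moreover have "T -` U \<inter> topspace X = {x \<in> topspace X. f (T x) \<in> V}"
      by (auto simp: U(1))
    ultimately show "openin X (T -` U \<inter> topspace X)"
      by simp
  qed (simp add: ultraweak_subbasis_UNIV)
qed (use assms(1) in auto)

lemma Hausdorff_ultraweak: "Hausdorff_space (ultraweak :: ('a::chilbert_space \<Rightarrow>\<^sub>L 'a) topology)"
  unfolding Hausdorff_space_def topspace_ultraweak
proof (intro allI impI)
  fix S T :: "'a \<Rightarrow>\<^sub>L 'a"
  assume ST: "S \<in> bounded_ops \<and> T \<in> bounded_ops \<and> S \<noteq> T"
  then obtain x where "blinfun_apply S x \<noteq> blinfun_apply T x"
    using blinfun_eqI by blast
  then obtain y where "cinner y (blinfun_apply S x) \<noteq> cinner y (blinfun_apply T x)"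
    using cinner_ext by blast
  then obtain U V where UV: "open U" "open V" "U \<inter> V = {}"
      "cinner y (blinfun_apply S x) \<in> U" "cinner y (blinfun_apply T x) \<in> V"
    using hausdorff by metis
  let ?pre = "\<lambda>W. {T \<in> bounded_ops. cinner y (blinfun_apply T x) \<in> W}"
  have "openin ultraweak (?pre W)" if "open W" for W
    using openin_continuous_map_preimage[OF
        continuous_map_ultraweak_functional[OF ultraweak_functional_vector[of y x]], of W] that
    by simp
  then show "\<exists>U V. openin ultraweak U \<and> openin ultraweak V \<and> S \<in> U \<and> T \<in> V \<and> disjnt U V"
    using UV ST by (intro exI[of _ "?pre U"] exI[of _ "?pre V"]) (auto simp: disjnt_def)
qed

definition complex_subspace :: "'a::complex_vector set \<Rightarrow> bool"
  where "complex_subspace M \<longleftrightarrow>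
    0 \<in> M \<and> (\<forall>x\<in>M. \<forall>y\<in>M. x + y \<in> M) \<and> (\<forall>c. \<forall>x\<in>M. c *\<^sub>C x \<in> M)"

lemma complex_subspaceD:
  assumes "complex_subspace M"
  shows "0 \<in> M" "x \<in> M \<Longrightarrow> y \<in> M \<Longrightarrow> x + y \<in> M" "x \<in> M \<Longrightarrow> c *\<^sub>C x \<in> M"
  using assms by (auto simp: complex_subspace_def)

lemma complex_subspace_imp_subspace: "complex_subspace M \<Longrightarrow> subspace M"
  unfolding complex_subspace_def subspace_def by (metis scaleC_of_real)

lemma clinear_onD:
  assumes "clinear_on M f"
  shows "x \<in> M \<Longrightarrow> y \<in> M \<Longrightarrow> f (x + y) = f x + f y" "x \<in> M \<Longrightarrow> f (c *\<^sub>C x) = c *\<^sub>C f x"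
  using assms by (auto simp: clinear_on_def)

lemma complex_subspace_bounded_ops: "complex_subspace bounded_ops"
  by (auto simp: complex_subspace_def bounded_ops_def blinfun.add_left scaleC_add_right
      scaleC_blinfun_apply scaleC_scaleC mult.commute)

lemma complex_subspace_span:
  assumes "\<And>c x. x \<in> G \<Longrightarrow> c *\<^sub>C x \<in> G"
  shows "complex_subspace (span G)"
proof -
  have "c *\<^sub>C x \<in> span G" if "x \<in> span G" for c x
    using that
  proof (induction rule: span_induct_alt)
    case (step r x y)
    have "c *\<^sub>C (r *\<^sub>R x + y) = r *\<^sub>R (c *\<^sub>C x) + c *\<^sub>C y"
      by (simp add: scaleC_add_right scaleC_of_real[symmetric] scaleC_scaleC mult.commute)
    then show ?case
      using step assms by (simp add: span_add span_base span_scale)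
  qed (simp add: span_zero)
  then show ?thesis
    by (auto simp: complex_subspace_def span_add span_zero)
qed

text \<open>Addition is separately continuous in the ultraweak topology, which suffices for the closure
  of a subspace to be closed under addition.\<close>

lemma complex_subspace_ultraweak_closure:
  fixes S :: "('a::chilbert_space \<Rightarrow>\<^sub>L 'a) set"
  assumes S: "complex_subspace S" "S \<subseteq> bounded_ops"
  shows "complex_subspace (ultraweak closure_of S)"
proof -
  let ?C = "ultraweak closure_of S"
  have sub: "S \<subseteq> ?C"
    using S(2) by (intro closure_of_subset) simp
  have C: "?C \<subseteq> bounded_ops"
    using closure_of_subset_topspace[of ultraweak S] by simp
  note ops = complex_subspaceD[OF complex_subspace_bounded_ops]
  have shift: "continuous_map ultraweak ultraweak (\<lambda>T. A + T)" if "A \<in> bounded_ops"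
    for A :: "'a \<Rightarrow>\<^sub>L 'a"
    by (rule continuous_map_ultraweakI)
      (use that in \<open>auto intro!: ops continuous_map_add
        intro: continuous_map_ultraweak_functional simp: ultraweak_functional_linear\<close>)
  have scale: "continuous_map ultraweak ultraweak (\<lambda>T :: 'a \<Rightarrow>\<^sub>L 'a. c *\<^sub>C T)" for c
    by (rule continuous_map_ultraweakI)
      (auto intro!: ops intro: continuous_map_ultraweak_functional[OF ultraweak_functional_scale]
        simp: ultraweak_functional_linear)
  have closed: "h ` ?C \<subseteq> ?C" if "continuous_map ultraweak ultraweak h" "h ` S \<subseteq> ?C" for h
  proof -
    have "h ` ?C \<subseteq> ultraweak closure_of (h ` S)"
      by (rule continuous_map_image_closure_subset[OF that(1)])
    also have "\<dots> \<subseteq> ?C"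
      by (rule closure_of_minimal[OF that(2)]) simp
    finally show ?thesis .
  qed
  have 1: "A + T \<in> ?C" if "A \<in> S" "T \<in> ?C" for A T
  proof -
    have "(\<lambda>T. A + T) ` ?C \<subseteq> ?C"
      by (rule closed[OF shift]) (use that S complex_subspaceD(2)[OF S(1)] sub in auto)
    then show ?thesis
      using that by auto
  qed
  have "A + T \<in> ?C" if "A \<in> ?C" "T \<in> ?C" for A T
  proof -
    have "(\<lambda>T. A + T) ` ?C \<subseteq> ?C"
      by (rule closed[OF shift]) (use that C 1 in \<open>auto simp: add.commute[of A]\<close>)
    then show ?thesis
      using that by auto
  qed
  moreover have "c *\<^sub>C T \<in> ?C" if "T \<in> ?C" for c T
  proof -
    have "(\<lambda>T. c *\<^sub>C T) ` ?C \<subseteq> ?C"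
      by (rule closed[OF scale]) (use complex_subspaceD(3)[OF S(1)] sub in auto)
    then show ?thesis
      using that by auto
  qed
  ultimately show ?thesis
    unfolding complex_subspace_def using complex_subspaceD(1)[OF S(1)] sub by auto
qed

text \<open>A linear continuous map is determined by its values on a generating set.  The target
  topology is left open so that this covers operator-valued maps and functionals alike.\<close>

lemma clinear_eq_on_ultraweak_closure:
  assumes G: "G \<subseteq> bounded_ops" "\<And>c x. x \<in> G \<Longrightarrow> c *\<^sub>C x \<in> G"
    and N: "N = ultraweak closure_of (span G)"
    and lin: "clinear_on N f" "clinear_on N g"
    and cont: "continuous_map (subtopology ultraweak N) Y f" "continuous_map (subtopology ultraweak N) Y g"
    and Y: "Hausdorff_space Y"
    and eq: "\<And>x. x \<in> G \<Longrightarrow> f x = g x"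
    and x: "x \<in> N"
  shows "f x = g x"
proof -
  have "span G \<subseteq> bounded_ops"
    using G(1) complex_subspace_imp_subspace[OF complex_subspace_bounded_ops] by (rule span_minimal)
  then have sub: "span G \<subseteq> N" and "complex_subspace N"
    unfolding N using complex_subspace_ultraweak_closure[OF complex_subspace_span[OF G(2)]]
    by (auto intro!: closure_of_subset)
  note N' = complex_subspaceD[OF \<open>complex_subspace N\<close>]
  have f0: "h 0 = 0" if "clinear_on N h" for h :: "('a \<Rightarrow>\<^sub>L 'a) \<Rightarrow> 'b"
    using clinear_onD(2)[OF that N'(1), of 0] by simp
  have "complex_subspace {x \<in> N. f x = g x}"
    unfolding complex_subspace_def using N' clinear_onD[OF lin(1)] clinear_onD[OF lin(2)]
    by (auto simp: f0[OF lin(1)] f0[OF lin(2)])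
  then have "span G \<subseteq> {x \<in> N. f x = g x}"
    by (intro span_minimal complex_subspace_imp_subspace) (use eq sub span_superset in blast)+
  moreover have "x \<in> subtopology ultraweak N closure_of (span G)"
    unfolding closure_of_subtopology using x sub N by (simp add: Int_absorb1)
  ultimately show ?thesis
    using forall_in_closure_of_eq[OF _ Y cont] by blast
qed

text \<open>This is the algebraic fact that \<open>\<phi>\<close> is a linear combination of \<open>F\<close>, stated without
  coefficients because the ultraweak functionals are closed under linear combinations.
  The induction removes one functional \<open>g\<close> of \<open>F\<close> by passing to the kernel of \<open>g\<close> in \<open>M\<close>; a
  multiple of \<open>g\<close> then corrects the functional obtained there.\<close>

lemma functional_of_common_kernel:
  assumes "finite F" "F \<subseteq> ultraweak_functionals" "complex_subspace M" "clinear_on M \<phi>"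
    and "\<And>x. x \<in> M \<Longrightarrow> (\<forall>f\<in>F. f x = 0) \<Longrightarrow> \<phi> x = (0::complex)"
  shows "\<exists>g\<in>ultraweak_functionals. \<forall>x\<in>M. \<phi> x = g x"
  using assms
proof (induction F arbitrary: M rule: finite_induct)
  case empty
  then show ?case
    using ultraweak_functional_zero by (intro bexI[of _ "\<lambda>_. 0"]) auto
next
  case (insert g F)
  have g: "g \<in> ultraweak_functionals"
    using insert.prems by simp
  note gl = ultraweak_functional_linear[OF g]
  note M = complex_subspaceD[OF insert.prems(2)]
  note \<phi> = clinear_onD[OF insert.prems(3), unfolded scaleC_complex_def]
  define M' where "M' = {x \<in> M. g x = 0}"
  have "\<exists>h\<in>ultraweak_functionals. \<forall>x\<in>M'. \<phi> x = h x"
  proof (rule insert.IH)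
    have "g 0 = 0"
      using gl(2)[of 0 0] by simp
    then show "complex_subspace M'"
      using M by (auto simp: complex_subspace_def M'_def gl)
    show "clinear_on M' \<phi>"
      using insert.prems(3) by (auto simp: clinear_on_def M'_def)
  qed (use insert.prems in \<open>auto simp: M'_def\<close>)
  then obtain h where h: "h \<in> ultraweak_functionals" "\<And>x. x \<in> M' \<Longrightarrow> \<phi> x = h x"
    by blast
  show ?case
  proof (cases "\<forall>x\<in>M. g x = 0")
    case True
    then show ?thesis
      using h by (auto simp: M'_def)
  next
    case False
    then obtain x0 where x0: "x0 \<in> M" "g x0 \<noteq> 0"
      by blast
    define x1 where "x1 = (1 / g x0) *\<^sub>C x0"
    have x1: "x1 \<in> M" "g x1 = 1"
      using x0 by (auto simp: x1_def M gl)
    have "\<phi> x = h x + (\<phi> x1 - h x1) * g x" if x: "x \<in> M" for x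
    proof -
      have "x + (- g x) *\<^sub>C x1 \<in> M'"
        using x x1 by (auto simp: M'_def gl intro!: M)
      from h(2)[OF this] show ?thesis
        using x x1 M by (simp add: \<phi> ultraweak_functional_linear[OF h(1)] algebra_simps)
    qed
    then show ?thesis
      by (intro bexI[OF _ ultraweak_functional_add[OF h(1) ultraweak_functional_scale[OF g, of "\<phi> x1 - h x1"]]]) simp
  qed
qed

lemma ultraweak_neighbourhood:
  assumes "generate_topology_on {f -` V | f V. f \<in> ultraweak_functionals \<and> open V} W" "x \<in> W"
  shows "\<exists>F e. finite F \<and> F \<subseteq> ultraweak_functionals \<and> e > 0 \<and>
    (\<forall>y. (\<forall>f\<in>F. dist (f y) (f x) < e) \<longrightarrow> y \<in> W)"
  using assms
proof (induction rule: generate_topology_on.induct)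
  case (Int a b)
  then have x: "x \<in> a" "x \<in> b"
    by auto
  obtain F e where F: "finite F" "F \<subseteq> ultraweak_functionals" "e > 0"
      "\<forall>y. (\<forall>f\<in>F. dist (f y) (f x) < e) \<longrightarrow> y \<in> a"
    using Int.IH(1)[OF x(1)] by (elim exE conjE) (rule that)
  obtain F' e' where F': "finite F'" "F' \<subseteq> ultraweak_functionals" "e' > 0"
      "\<forall>y. (\<forall>f\<in>F'. dist (f y) (f x) < e') \<longrightarrow> y \<in> b"
    using Int.IH(2)[OF x(2)] by (elim exE conjE) (rule that)
  show ?case
    using F F' by (intro exI[of _ "F \<union> F'"] exI[of _ "min e e'"]) auto
next
  case (UN K)
  then obtain k where k: "k \<in> K" "x \<in> k"
    by blast
  obtain F e where F: "finite F" "F \<subseteq> ultraweak_functionals" "e > 0"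
      "\<forall>y. (\<forall>f\<in>F. dist (f y) (f x) < e) \<longrightarrow> y \<in> k"
    using UN.IH[OF k] by (elim exE conjE) (rule that)
  then show ?case
    using k(1) by (intro exI[of _ F] exI[of _ e]) blast
next
  case (Basis s)
  then obtain f V where s: "s = f -` V" "f \<in> ultraweak_functionals" "open V"
    by blast
  then obtain e where "e > 0" "\<And>z. dist z (f x) < e \<Longrightarrow> z \<in> V"
    using Basis.prems open_dist by (metis vimageE)
  then show ?case
    using s by (intro exI[of _ "{f}"] exI[of _ e]) auto
qed auto

text \<open>An ultraweakly continuous linear functional on \<open>M\<close> is bounded on a neighbourhood of
  \<open>0\<close> that contains the common kernel of finitely many functionals of the defining family; hence
  it vanishes on that kernel, and it extends to all operators as a series of the defining form.\<close>

lemma ultraweakly_continuous_functional_extends: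
  assumes M: "complex_subspace M" "M \<subseteq> bounded_ops"
    and \<phi>: "clinear_on M \<phi>" "ultraweakly_continuous_functional M \<phi>"
  shows "\<exists>g\<in>ultraweak_functionals. \<forall>x\<in>M. \<phi> x = g x"
proof -
  note M' = complex_subspaceD[OF M(1)]
  have \<phi>0: "\<phi> 0 = 0"
    using clinear_onD(2)[OF \<phi>(1) M'(1), of 0] by simp
  have top: "topspace (subtopology ultraweak M) = M"
    using M(2) by auto
  have "openin (subtopology ultraweak M) {x \<in> topspace (subtopology ultraweak M). \<phi> x \<in> ball 0 1}"
    using \<phi>(2) unfolding ultraweakly_continuous_functional_def
    by (rule openin_continuous_map_preimage) auto
  then obtain W' where W': "openin ultraweak W'" "{x \<in> M. \<phi> x \<in> ball 0 1} = W' \<inter> M"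
    unfolding top openin_subtopology by (elim exE conjE) (rule that)
  obtain W where W: "generate_topology_on {f -` V | f V. f \<in> ultraweak_functionals \<and> open V} W"
      and "W' = W \<inter> bounded_ops"
    using W'(1) unfolding ultraweak_def openin_subtopology openin_topology_generated_by_iff
    by (elim exE conjE) (rule that)
  then have eq: "{x \<in> M. \<phi> x \<in> ball 0 1} = W \<inter> bounded_ops \<inter> M"
    using W'(2) by simp
  have "0 \<in> W"
    using eq M' M(2) \<phi>0 by auto
  from ultraweak_neighbourhood[OF W this]
  obtain F e where F: "finite F" "F \<subseteq> ultraweak_functionals" "e > 0"
      "\<forall>y. (\<forall>f\<in>F. dist (f y) (f 0) < e) \<longrightarrow> y \<in> W"
    by (elim exE conjE) (rule that)
  have "\<phi> x = 0" if x: "x \<in> M" "\<forall>f\<in>F. f x = 0" for x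
  proof (rule ccontr)
    assume "\<phi> x \<noteq> 0"
    define y where "y = (1 / \<phi> x) *\<^sub>C x"
    have y: "y \<in> M" "\<phi> y = 1"
      using x \<open>\<phi> x \<noteq> 0\<close> M' clinear_onD(2)[OF \<phi>(1)] by (auto simp: y_def scaleC_complex_def)
    have "dist (f y) (f 0) < e" if "f \<in> F" for f
    proof -
      have "f \<in> ultraweak_functionals"
        using that F by blast
      note f = ultraweak_functional_linear(2)[OF this]
      show ?thesis
        using f[of 0 0] f[of "1 / \<phi> x" x] bspec[OF x(2) that] F(3) by (simp add: y_def)
    qed
    then have "y \<in> W"
      by (intro F(4)[rule_format])
    then have "y \<in> {x \<in> M. \<phi> x \<in> ball 0 1}"
      unfolding eq using y M(2) by blast
    then show False
      using y by simp
  qed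
  then show ?thesis
    by (intro functional_of_common_kernel[OF F(1,2) M(1) \<phi>(1)]) blast
qed

section \<open>Von Neumann algebras\<close>

text \<open>All four properties come from the description of \<open>M\<close> as a commutant.  For closedness, commuting
  with a fixed operator is tested by vector functionals, which are ultraweakly continuous.\<close>

lemma von_neumann_algebraD:
  assumes M: "von_neumann_algebra M"
  shows "M \<subseteq> bounded_ops" "complex_subspace M" "id_blinfun \<in> M" "ultraweak closure_of M = M"
proof -
  show ops: "M \<subseteq> bounded_ops"
    using M by (simp add: von_neumann_algebra_def)
  have comm: "T \<in> M \<longleftrightarrow> T \<in> bounded_ops \<and> (\<forall>S\<in>commutant M. T o\<^sub>L S = S o\<^sub>L T)" for T
    using M unfolding von_neumann_algebra_def commutant_def[of "commutant M"] by blast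
  have ops': "S \<in> bounded_ops" if "S \<in> commutant M" for S
    using that by (simp add: commutant_def)
  show "id_blinfun \<in> M"
    unfolding comm by (auto simp: bounded_ops_def intro!: blinfun_eqI)
  have comm': "T \<in> M \<longleftrightarrow> T \<in> bounded_ops \<and>
      (\<forall>S\<in>commutant M. \<forall>x. blinfun_apply T (blinfun_apply S x) = blinfun_apply S (blinfun_apply T x))" for T
    unfolding comm blinfun_apply_inject[symmetric] fun_eq_iff by simp
  have scale: "blinfun_apply S (c *\<^sub>C x) = c *\<^sub>C blinfun_apply S x" if "S \<in> commutant M" for S c x
    using ops'[OF that] by (simp add: bounded_ops_def)
  have commute: "blinfun_apply T (blinfun_apply S x) = blinfun_apply S (blinfun_apply T x)"
    if "T \<in> M" "S \<in> commutant M" for S T x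
    using that comm' by blast
  note lin = complex_subspaceD[OF complex_subspace_bounded_ops]
  have "0 \<in> M"
    unfolding comm'[of 0] by (simp add: lin)
  moreover have "T + R \<in> M" if "T \<in> M" "R \<in> M" for T R
    unfolding comm'[of "T + R"] using that ops
    by (auto intro!: lin simp: blinfun.add_left blinfun.add_right commute)
  moreover have "c *\<^sub>C T \<in> M" if "T \<in> M" for c T
    unfolding comm'[of "c *\<^sub>C T"] using that ops
    by (auto intro!: lin simp: scaleC_blinfun_apply scale commute)
  ultimately show "complex_subspace M"
    unfolding complex_subspace_def by blast
  show "ultraweak closure_of M = M"
  proof (rule subset_antisym)
    show "M \<subseteq> ultraweak closure_of M"
      using ops by (intro closure_of_subset) simp
    show "ultraweak closure_of M \<subseteq> M"
    proof
      fix T assume T: "T \<in> ultraweak closure_of M"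
      have "T o\<^sub>L S = S o\<^sub>L T" if S: "S \<in> commutant M" for S
      proof (rule blinfun_eqI, rule cinner_ext)
        fix x y
        note adjS = cinner_adj[OF ops'[OF S, unfolded bounded_ops_iff]]
        \<comment> \<open>Moving \<open>S\<close> to the other side turns both sides into ultraweakly continuous functions of \<open>T\<close>.\<close>
        have "cinner y (blinfun_apply T (blinfun_apply S x))
            = cinner (blinfun_apply (adj S) y) (blinfun_apply T x)"
        proof (rule forall_in_closure_of_eq[OF T, of euclidean])
          fix R assume "R \<in> M"
          then have "R o\<^sub>L S = S o\<^sub>L R"
            using S comm by blast
          then show "cinner y (blinfun_apply R (blinfun_apply S x))
              = cinner (blinfun_apply (adj S) y) (blinfun_apply R x)"
            unfolding adjS by (metis blinfun_apply_blinfun_compose)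
        qed (auto intro: continuous_map_ultraweak_functional ultraweak_functional_vector)
        then show "cinner y (blinfun_apply (T o\<^sub>L S) x) = cinner y (blinfun_apply (S o\<^sub>L T) x)"
          by (simp add: adjS)
      qed
      moreover have "T \<in> bounded_ops"
        using T closure_of_subset_topspace[of ultraweak M] by auto
      ultimately show "T \<in> M"
        unfolding comm by blast
    qed
  qed
qed

section \<open>Tensor products of Hilbert spaces and operators\<close>

lemma has_sum_finite_sum:
  fixes f :: "'i \<Rightarrow> 'j \<Rightarrow> 'c::real_normed_vector"
  assumes "finite I" "\<And>i. i \<in> I \<Longrightarrow> (f i has_sum s i) A"
  shows "((\<lambda>x. \<Sum>i\<in>I. f i x) has_sum (\<Sum>i\<in>I. s i)) A"
  using assms by (induction I rule: finite_induct) (auto intro: has_sum_add)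

locale tensor_product =
  fixes t :: "'a::chilbert_space \<Rightarrow> 'b::chilbert_space \<Rightarrow> 'k::chilbert_space"
  assumes hilbert_tensor: "hilbert_tensor t"
begin

lemma
  shows tensor_add_left: "t (u + u') v = t u v + t u' v"
    and tensor_add_right: "t u (v + v') = t u v + t u v'"
    and tensor_scaleC_left: "t (c *\<^sub>C u) v = c *\<^sub>C t u v"
    and tensor_scaleC_right: "t u (c *\<^sub>C v) = c *\<^sub>C t u v"
    and cinner_tensor: "cinner (t u v) (t u' v') = cinner u u' * cinner v v'"
    and closure_span_tensors: "closure (span {t x y | x y. True}) = UNIV"
  using hilbert_tensor unfolding hilbert_tensor_def by blast+

lemma norm_tensor: "norm (t u v) = norm u * norm v"
proof -
  have "(norm (t u v))\<^sup>2 = (norm u * norm v)\<^sup>2"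
    by (simp add: norm_cinner_self[symmetric] cinner_tensor norm_mult power_mult_distrib)
  then show ?thesis
    by simp
qed

lemma bounded_linear_tensor_left: "bounded_linear (\<lambda>u. t u v)"
  by (rule bounded_linear_intro[where K = "norm v"])
    (simp_all add: tensor_add_left norm_tensor scaleC_of_real[symmetric] tensor_scaleC_left)

lemma bounded_linear_tensor_right: "bounded_linear (t u)"
  by (rule bounded_linear_intro[where K = "norm u"])
    (simp_all add: tensor_add_right norm_tensor scaleC_of_real[symmetric] tensor_scaleC_right)

lemma closed_subspace_tensor_UNIV:
  assumes "closed S" "subspace S" "\<And>u v. t u v \<in> S"
  shows "\<xi> \<in> S"
proof -
  have "span {t x y | x y. True} \<subseteq> S"
    using assms(2,3) by (intro span_minimal) auto
  then have "closure (span {t x y | x y. True}) \<subseteq> S"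
    using assms(1) by (rule closure_minimal)
  then show ?thesis
    using closure_span_tensors by blast
qed

lemma blinfun_eqI_tensor:
  assumes "\<And>u v. blinfun_apply S (t u v) = blinfun_apply T (t u v)"
  shows "S = T"
proof (rule blinfun_eqI)
  fix \<xi>
  have "\<xi> \<in> {\<xi>. blinfun_apply S \<xi> = blinfun_apply T \<xi>}"
    by (rule closed_subspace_tensor_UNIV)
      (auto simp: assms subspace_def blinfun.add_right blinfun.scaleR_right
        intro!: closed_Collect_eq continuous_intros)
  then show "blinfun_apply S \<xi> = blinfun_apply T \<xi>"
    by simp
qed

lemma tensor_total:
  assumes "\<And>u v. cinner (t u v) \<xi> = 0"
  shows "\<xi> = 0"
proof -
  have "\<xi> \<in> {\<zeta>. cinner \<zeta> \<xi> = 0}"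
    by (rule closed_subspace_tensor_UNIV)
      (auto simp: assms subspace_def cinner.add_left cinner.scaleR_left
        intro!: closed_Collect_eq cinner.continuous_on continuous_intros)
  then show ?thesis
    using cinner_self[of \<xi>] by simp
qed

text \<open>The adjoint of \<open>leg v\<close> takes the inner product with \<open>v\<close> in the second factor, so
  that \<open>u \<otimes> w\<close> goes to \<open>\<langle>v, w\<rangle> u\<close>.\<close>

definition leg :: "'b \<Rightarrow> ('a \<Rightarrow>\<^sub>L 'k)"
  where "leg v = Blinfun (\<lambda>u. t u v)"

lemma leg_apply [simp]: "blinfun_apply (leg v) u = t u v"
  by (simp add: leg_def bounded_linear_Blinfun_apply bounded_linear_tensor_left)

lemma complex_linear_leg: "complex_linear (leg v)"
  by (simp add: complex_linear_def tensor_scaleC_left)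

lemma norm_leg_le: "norm (leg v) \<le> norm v"
  by (rule norm_blinfun_bound) (simp_all add: norm_tensor mult.commute)

lemmas cinner_adj_leg = cinner_adj_right[OF complex_linear_leg, unfolded leg_apply]

lemma adj_leg_tensor: "blinfun_apply (adj (leg v)) (t u w) = cinner v w *\<^sub>C u"
  by (rule cinner_ext) (simp add: cinner_adj_leg cinner_tensor cinner_scaleC_right mult.commute)

text \<open>For an orthonormal basis \<open>B\<close> of the second factor, the tensor product is the orthogonal sum
  of copies of the first factor, one for each \<open>e\<close>, and \<open>adj (leg e) \<xi>\<close> is the coordinate of \<open>\<xi>\<close>
  in the copy at \<open>e\<close>.  What the expansion misses is orthogonal to \<open>u \<otimes> f\<close> for all basis
  vectors \<open>f\<close>, hence to all simple tensors, by expanding their second factor.\<close>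

lemma leg_expansion:
  assumes B: "orthonormal_basis B"
  shows "((\<lambda>e. t (blinfun_apply (adj (leg e)) \<xi>) e) has_sum \<xi>) B"
    and "(\<lambda>e. blinfun_apply (adj (leg e)) \<xi>) square_summable_on B"
    and "(\<Sum>\<^sub>\<infinity>e\<in>B. (norm (blinfun_apply (adj (leg e)) \<xi>))\<^sup>2) \<le> (norm \<xi>)\<^sup>2"
proof -
  define w where "w = (\<lambda>e. t (blinfun_apply (adj (leg e)) \<xi>) e)"
  have norm_w: "norm (w e) = norm (blinfun_apply (adj (leg e)) \<xi>)" if "e \<in> B" for e
    using B that by (simp add: w_def norm_tensor orthonormal_basis_def)
  have orth: "pairwise (\<lambda>i j. inner (w i) (w j) = 0) B"
    by (auto simp: w_def pairwise_def inner_eq_Re_cinner cinner_tensor orthonormal_basisD[OF B])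
  have proj: "inner (w e) \<xi> = (norm (w e))\<^sup>2" if "e \<in> B" for e
    unfolding norm_w[OF that]
    by (simp add: w_def inner_eq_Re_cinner cinner_adj_leg[symmetric] cinner_self del: of_real_power)
  have bessel: "w square_summable_on B" "w summable_on B"
      "(\<Sum>\<^sub>\<infinity>e\<in>B. (norm (w e))\<^sup>2) \<le> (norm \<xi>)\<^sup>2"
    by (rule bessel[OF orth]; rule proj; assumption)+
  show "(\<lambda>e. blinfun_apply (adj (leg e)) \<xi>) square_summable_on B"
    using bessel(1) by (simp add: norm_w cong: summable_on_cong)
  show "(\<Sum>\<^sub>\<infinity>e\<in>B. (norm (blinfun_apply (adj (leg e)) \<xi>))\<^sup>2) \<le> (norm \<xi>)\<^sup>2"
    using bessel(3) by (simp add: norm_w cong: infsum_cong)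
  have orth_basis: "cinner (t u f) (\<xi> - infsum w B) = 0" if f: "f \<in> B" for u f
  proof -
    have "((\<lambda>e. cinner (t u f) (w e)) has_sum cinner (t u f) (infsum w B)) B"
      by (rule has_sum_bounded_linear[OF cinner.bounded_linear_right]) (simp add: bessel)
    moreover have "((\<lambda>e. cinner (t u f) (w e)) has_sum cinner (t u f) \<xi>) B"
      using f
      by (intro has_sum_finite_neutralI[where B = "{f}"])
        (auto simp: w_def cinner_tensor cinner_adj_leg orthonormal_basisD[OF B])
    ultimately show ?thesis
      using has_sum_unique by (auto simp: cinner.diff_right)
  qed
  have "\<xi> - infsum w B = 0"
  proof (rule tensor_total)
    fix u v
    have "bounded_linear (\<lambda>v. cinner (t u v) (\<xi> - infsum w B))"
      by (rule bounded_linear_compose[OF cinner.bounded_linear_left bounded_linear_tensor_right])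
    from has_sum_bounded_linear[OF this orthonormal_expansion[OF B, of v]]
    have "((\<lambda>e. cinner (t u (cinner e v *\<^sub>C e)) (\<xi> - infsum w B)) has_sum cinner (t u v) (\<xi> - infsum w B)) B" .
    moreover have "((\<lambda>e. cinner (t u (cinner e v *\<^sub>C e)) (\<xi> - infsum w B)) has_sum 0) B"
      by (rule has_sum_0) (simp add: tensor_scaleC_right cinner_scaleC_left orth_basis)
    ultimately show "cinner (t u v) (\<xi> - infsum w B) = 0"
      by (rule has_sum_unique)
  qed
  then show "((\<lambda>e. t (blinfun_apply (adj (leg e)) \<xi>) e) has_sum \<xi>) B"
    using has_sum_infsum[OF bessel(2)] by (simp add: w_def)
qed

text \<open>An operator on the first factor acts in each of the orthogonal copies separately.  Hence the
  series of the images is orthogonal, and its norm is at most \<open>norm a\<close> times that of \<open>\<xi>\<close>.\<close>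

lemma amplification_exists:
  assumes a: "complex_linear a"
  shows "\<exists>A. complex_linear A \<and> (\<forall>u v. blinfun_apply A (t u v) = t (blinfun_apply a u) v)"
proof -
  obtain B :: "'b set" where B: "orthonormal_basis B"
    using orthonormal_basis_exists by blast
  define w where "w \<xi> e = t (blinfun_apply a (blinfun_apply (adj (leg e)) \<xi>)) e" for \<xi> e
  have orth: "pairwise (\<lambda>i j. inner (w \<xi> i) (w \<xi> j) = 0) B" for \<xi>
    by (auto simp: w_def pairwise_def inner_eq_Re_cinner cinner_tensor orthonormal_basisD[OF B])
  have le: "(norm (w \<xi> e))\<^sup>2 \<le> (norm a)\<^sup>2 * (norm (blinfun_apply (adj (leg e)) \<xi>))\<^sup>2"
    if "e \<in> B" for \<xi> e
  proof -
    have "norm (w \<xi> e) \<le> norm a * norm (blinfun_apply (adj (leg e)) \<xi>)"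
      using B that norm_blinfun by (simp add: w_def norm_tensor orthonormal_basis_def)
    then show ?thesis
      by (metis norm_ge_zero power_mono power_mult_distrib)
  qed
  have bound: "(\<lambda>e. (norm a)\<^sup>2 * (norm (blinfun_apply (adj (leg e)) \<xi>))\<^sup>2) summable_on B" for \<xi>
    by (intro summable_on_cmult_right leg_expansion(2)[OF B])
  have sq: "w \<xi> square_summable_on B" for \<xi>
    by (rule summable_on_comparison_test[OF bound le]) auto
  have w: "w \<xi> summable_on B" for \<xi>
    by (rule orthogonal_summable_on[OF orth sq])
  define A where "A \<xi> = infsum (w \<xi>) B" for \<xi>
  have A: "(w \<xi> has_sum A \<xi>) B" for \<xi>
    unfolding A_def by (rule has_sum_infsum[OF w])
  have w_lin: "w (\<xi> + \<zeta>) e = w \<xi> e + w \<zeta> e" "w (c *\<^sub>C \<xi>) e = c *\<^sub>C w \<xi> e" for \<xi> \<zeta> e c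
    by (simp_all add: w_def blinfun.add_right tensor_add_left tensor_scaleC_left
        complex_linearD[OF a] complex_linearD[OF complex_linear_adj[OF complex_linear_leg]])
  have A_add: "A (\<xi> + \<zeta>) = A \<xi> + A \<zeta>" for \<xi> \<zeta>
    using has_sum_add[OF A A, of \<xi> \<zeta>] A[of "\<xi> + \<zeta>"] unfolding w_lin by (metis has_sum_unique)
  have A_scale: "A (c *\<^sub>C \<xi>) = c *\<^sub>C A \<xi>" for c \<xi>
    using has_sum_bounded_linear[OF bounded_linear_scaleC A, of c \<xi>] A[of "c *\<^sub>C \<xi>"]
    unfolding w_lin by (metis has_sum_unique)
  have norm_A: "norm (A \<xi>) \<le> norm \<xi> * norm a" for \<xi>
  proof -
    have "(norm (A \<xi>))\<^sup>2 = (\<Sum>\<^sub>\<infinity>e\<in>B. (norm (w \<xi> e))\<^sup>2)"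
      unfolding A_def by (rule infsumI[symmetric, OF orthogonal_norm_infsum[OF orth w]])
    also have "\<dots> \<le> (\<Sum>\<^sub>\<infinity>e\<in>B. (norm a)\<^sup>2 * (norm (blinfun_apply (adj (leg e)) \<xi>))\<^sup>2)"
      by (rule infsum_mono[OF sq bound le])
    also have "\<dots> = (norm a)\<^sup>2 * (\<Sum>\<^sub>\<infinity>e\<in>B. (norm (blinfun_apply (adj (leg e)) \<xi>))\<^sup>2)"
      by (rule infsum_cmult_right')
    also have "\<dots> \<le> (norm a)\<^sup>2 * (norm \<xi>)\<^sup>2"
      by (rule mult_left_mono[OF leg_expansion(3)[OF B]]) simp
    finally have "(norm (A \<xi>))\<^sup>2 \<le> (norm \<xi> * norm a)\<^sup>2"
      by (simp add: power_mult_distrib mult.commute)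
    then show ?thesis
      by (rule power2_le_imp_le) simp
  qed
  have "bounded_linear A"
    by (rule bounded_linear_intro[OF A_add _ norm_A]) (simp add: scaleC_of_real[symmetric] A_scale)
  then have apply_A: "blinfun_apply (Blinfun A) = A"
    by (rule bounded_linear_Blinfun_apply)
  have "A (t u v) = t (blinfun_apply a u) v" for u v
  proof -
    have "w (t u v) = (\<lambda>e. t (blinfun_apply a u) (cinner e v *\<^sub>C e))"
      by (rule ext)
        (simp add: w_def adj_leg_tensor complex_linearD[OF a] tensor_scaleC_left tensor_scaleC_right)
    then have "(w (t u v) has_sum t (blinfun_apply a u) v) B"
      using has_sum_bounded_linear[OF bounded_linear_tensor_right orthonormal_expansion[OF B, of v]]
      by simp
    then show ?thesis
      using A has_sum_unique by blast
  qed
  then show ?thesis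
    by (intro exI[of _ "Blinfun A"]) (simp add: apply_A complex_linear_def A_scale)
qed

text \<open>Exchanging the factors carries statements about the first factor over to the second.\<close>

lemma tensor_product_swap: "tensor_product (\<lambda>v u. t u v)"
proof
  have "{t y x | x y. True} = {t x y | x y. True}"
    by blast
  then have "closure (span {t y x | x y. True}) = UNIV"
    using closure_span_tensors by (simp only:)
  then show "hilbert_tensor (\<lambda>v u. t u v)"
    unfolding hilbert_tensor_def
    by (simp add: tensor_add_left tensor_add_right tensor_scaleC_left tensor_scaleC_right
        cinner_tensor mult.commute)
qed

text \<open>The operator \<open>a \<otimes> b\<close> is the product of \<open>a \<otimes> 1\<close> and \<open>1 \<otimes> b\<close>, each of which is
  an amplification.\<close>

lemma op_tensor_bounded_ops:
  assumes "a \<in> bounded_ops" "b \<in> bounded_ops"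
  shows "op_tensor t a b \<in> bounded_ops"
    and op_tensor_apply:
      "blinfun_apply (op_tensor t a b) (t u v) = t (blinfun_apply a u) (blinfun_apply b v)"
proof -
  interpret swap: tensor_product "\<lambda>v u. t u v"
    by (rule tensor_product_swap)
  obtain A where A: "complex_linear A" "\<And>u v. blinfun_apply A (t u v) = t (blinfun_apply a u) v"
    using amplification_exists assms(1) unfolding bounded_ops_iff by blast
  obtain B where B: "complex_linear B" "\<And>u v. blinfun_apply B (t u v) = t u (blinfun_apply b v)"
    using swap.amplification_exists assms(2) unfolding bounded_ops_iff by blast
  have "\<exists>!T. T \<in> bounded_ops \<and>
      (\<forall>x y. blinfun_apply T (t x y) = t (blinfun_apply a x) (blinfun_apply b y))"
  proof (rule ex1I[of _ "A o\<^sub>L B"])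
    show "A o\<^sub>L B \<in> bounded_ops \<and>
        (\<forall>x y. blinfun_apply (A o\<^sub>L B) (t x y) = t (blinfun_apply a x) (blinfun_apply b y))"
      using A B by (simp add: bounded_ops_iff complex_linear_def)
    show "T = A o\<^sub>L B" if "T \<in> bounded_ops \<and>
        (\<forall>x y. blinfun_apply T (t x y) = t (blinfun_apply a x) (blinfun_apply b y))" for T
      using that A B by (intro blinfun_eqI_tensor) simp
  qed
  from theI'[OF this] show "op_tensor t a b \<in> bounded_ops"
    "blinfun_apply (op_tensor t a b) (t u v) = t (blinfun_apply a u) (blinfun_apply b v)"
    unfolding op_tensor_def by blast+
qed

lemma id_bounded_ops: "id_blinfun \<in> bounded_ops"
  by (simp add: bounded_ops_def)

lemma op_tensor_id: "op_tensor t id_blinfun id_blinfun = id_blinfun"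
  by (rule blinfun_eqI_tensor) (simp add: op_tensor_apply id_bounded_ops)

lemma op_tensor_add_left:
  assumes "a \<in> bounded_ops" "a' \<in> bounded_ops" "b \<in> bounded_ops"
  shows "op_tensor t (a + a') b = op_tensor t a b + op_tensor t a' b"
  by (rule blinfun_eqI_tensor)
    (simp add: op_tensor_apply assms complex_subspaceD[OF complex_subspace_bounded_ops]
      blinfun.add_left tensor_add_left)

lemma op_tensor_scaleC_left:
  assumes "a \<in> bounded_ops" "b \<in> bounded_ops"
  shows "op_tensor t (c *\<^sub>C a) b = c *\<^sub>C op_tensor t a b"
  by (rule blinfun_eqI_tensor)
    (simp add: op_tensor_apply assms complex_subspaceD[OF complex_subspace_bounded_ops]
      scaleC_blinfun_apply tensor_scaleC_left)

section \<open>The amplification\<close>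

lemma cinner_amplification:
  assumes B: "orthonormal_basis B" and a: "a \<in> bounded_ops"
  shows "((\<lambda>e. cinner (blinfun_apply (adj (leg e)) \<eta>)
      (blinfun_apply a (blinfun_apply (adj (leg e)) \<xi>)))
    has_sum cinner \<eta> (blinfun_apply (op_tensor t a id_blinfun) \<xi>)) B"
proof -
  have "bounded_linear (\<lambda>\<xi>. cinner \<eta> (blinfun_apply (op_tensor t a id_blinfun) \<xi>))"
    by (rule bounded_linear_compose[OF cinner.bounded_linear_right blinfun.bounded_linear_right])
  from has_sum_bounded_linear[OF this leg_expansion(1)[OF B, of \<xi>]] show ?thesis
    by (simp add: op_tensor_apply a id_bounded_ops cinner_adj[OF complex_linear_leg])
qed

text \<open>By the expansion above, a series of vector functionals composed with the amplification is a
  double series of vector functionals, indexed by the terms and the basis vectors.\<close>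

lemma continuous_map_amplification:
  assumes M: "M \<subseteq> bounded_ops"
  shows "continuous_map (subtopology ultraweak M) ultraweak (\<lambda>x. op_tensor t x id_blinfun)"
proof (rule continuous_map_ultraweakI)
  show "op_tensor t x id_blinfun \<in> bounded_ops" if "x \<in> topspace (subtopology ultraweak M)" for x
    using that by (intro op_tensor_bounded_ops id_bounded_ops) auto
  fix f :: "('k \<Rightarrow>\<^sub>L 'k) \<Rightarrow> complex"
  assume "f \<in> ultraweak_functionals"
  then obtain \<xi> \<eta> :: "nat \<Rightarrow> 'k" where sq: "\<xi> square_summable_on UNIV" "\<eta> square_summable_on UNIV"
    and f: "\<And>T. f T = (\<Sum>\<^sub>\<infinity>n. cinner (\<eta> n) (blinfun_apply T (\<xi> n)))"
    by (rule ultraweak_functionalE) blast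
  obtain B :: "'b set" where B: "orthonormal_basis B"
    using orthonormal_basis_exists by blast
  define p where "p \<zeta> = (\<lambda>(n, e). blinfun_apply (adj (leg e)) (\<zeta> n))" for \<zeta> :: "nat \<Rightarrow> 'k"
  have p: "p \<zeta> square_summable_on (UNIV \<times> B)" if "\<zeta> square_summable_on UNIV" for \<zeta>
  proof (rule summable_on_SigmaI)
    show "((\<lambda>e. (norm (p \<zeta> (n, e)))\<^sup>2) has_sum
        (\<Sum>\<^sub>\<infinity>e\<in>B. (norm (blinfun_apply (adj (leg e)) (\<zeta> n)))\<^sup>2)) B" for n
      using has_sum_infsum[OF leg_expansion(2)[OF B, of "\<zeta> n"]] by (simp add: p_def)
    show "(\<lambda>n. \<Sum>\<^sub>\<infinity>e\<in>B. (norm (blinfun_apply (adj (leg e)) (\<zeta> n)))\<^sup>2) summable_on UNIV"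
      by (rule summable_on_comparison_test[OF that leg_expansion(3)[OF B]])
        (simp add: infsum_nonneg)
  qed simp
  define g where
    "g = (\<lambda>T. \<Sum>\<^sub>\<infinity>i\<in>UNIV \<times> B. cinner (p \<eta> i) (blinfun_apply T (p \<xi> i)))"
  have "g \<in> ultraweak_functionals"
    unfolding g_def by (rule ultraweak_functionalI[OF p[OF sq(1)] p[OF sq(2)]])
  then have "continuous_map (subtopology ultraweak M) euclidean g"
    by (intro continuous_map_from_subtopology continuous_map_ultraweak_functional)
  then show "continuous_map (subtopology ultraweak M) euclidean (\<lambda>x. f (op_tensor t x id_blinfun))"
  proof (rule continuous_map_eq)
    fix x assume "x \<in> topspace (subtopology ultraweak M)"
    then have x: "x \<in> bounded_ops"
      by simp
    have "g x = (\<Sum>\<^sub>\<infinity>n. \<Sum>\<^sub>\<infinity>e\<in>B. cinner (p \<eta> (n, e)) (blinfun_apply x (p \<xi> (n, e))))"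
      unfolding g_def
      by (rule infsum_Sigma_banach[symmetric], rule cinner_summable_on[OF p[OF sq(1)] p[OF sq(2)]])
    also have "\<dots> = f (op_tensor t x id_blinfun)"
      unfolding f p_def prod.case by (intro infsum_cong infsumI cinner_amplification[OF B x])
    finally show "g x = f (op_tensor t x id_blinfun)" .
  qed
qed

text \<open>The quadratic form of an amplified matrix is the sum of the quadratic forms of the
  original matrix in the orthogonal copies of the first factor.\<close>

lemma completely_positive_on_amplification:
  assumes M: "M \<subseteq> bounded_ops"
  shows "completely_positive_on M (\<lambda>x. op_tensor t x id_blinfun)"
  unfolding completely_positive_on_def
proof (intro allI impI)
  fix n and X :: "nat \<Rightarrow> nat \<Rightarrow> ('a \<Rightarrow>\<^sub>L 'a)"
  assume X: "\<forall>i<n. \<forall>j<n. X i j \<in> M" and pos: "positive_matrix n X"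
  obtain B :: "'b set" where B: "orthonormal_basis B"
    using orthonormal_basis_exists by blast
  show "positive_matrix n (\<lambda>i j. op_tensor t (X i j) id_blinfun)"
    unfolding positive_matrix_def
  proof
    fix \<xi> :: "nat \<Rightarrow> 'k"
    let ?q = "\<lambda>e. \<Sum>i<n. \<Sum>j<n. cinner (blinfun_apply (adj (leg e)) (\<xi> i))
        (blinfun_apply (X i j) (blinfun_apply (adj (leg e)) (\<xi> j)))"
    let ?s = "\<Sum>i<n. \<Sum>j<n. cinner (\<xi> i) (blinfun_apply (op_tensor t (X i j) id_blinfun) (\<xi> j))"
    have "(?q has_sum ?s) B"
      by (intro has_sum_finite_sum cinner_amplification[OF B]) (use X M in auto)
    moreover have "0 \<le> ?q e" for e
      using pos[unfolded positive_matrix_def, rule_format, of "\<lambda>i. blinfun_apply (adj (leg e)) (\<xi> i)"]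
      unfolding nonneg_Reals_iff_le .
    ultimately have "0 \<le> ?s"
      using infsum_nonneg_complex[of ?q B] by (auto simp: has_sum_iff)
    then show "?s \<in> \<real>\<^sub>\<ge>\<^sub>0"
      unfolding nonneg_Reals_iff_le .
  qed
qed

end

section \<open>Slice maps\<close>

context tensor_product
begin

text \<open>The slice of \<open>x\<close> is the norm-convergent series of the operators
  \<open>adj (leg (\<eta> n)) x (leg (\<xi> n))\<close>.\<close>

lemma slice_operator_exists:
  fixes \<xi> \<eta> :: "nat \<Rightarrow> 'b"
  assumes sq: "\<xi> square_summable_on UNIV" "\<eta> square_summable_on UNIV"
  shows "\<exists>E :: ('k \<Rightarrow>\<^sub>L 'k) \<Rightarrow> ('a \<Rightarrow>\<^sub>L 'a). \<forall>x u v.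
    ((\<lambda>n. cinner (t u (\<eta> n)) (blinfun_apply x (t v (\<xi> n)))) has_sum cinner u (blinfun_apply (E x) v)) UNIV"
proof (intro exI allI)
  fix x :: "'k \<Rightarrow>\<^sub>L 'k" and u v
  let ?s = "\<lambda>x n. adj (leg (\<eta> n)) o\<^sub>L x o\<^sub>L leg (\<xi> n)"
  have "?s x summable_on UNIV"
  proof (rule abs_summable_summable, rule summable_on_comparison_test)
    show "(\<lambda>n. norm x * ((norm (\<eta> n))\<^sup>2 + (norm (\<xi> n))\<^sup>2)) summable_on UNIV"
      by (intro summable_on_cmult_right summable_on_add sq)
    show "norm (?s x n) \<le> norm x * ((norm (\<eta> n))\<^sup>2 + (norm (\<xi> n))\<^sup>2)" for n
    proof -
      have "norm (?s x n) \<le> norm (adj (leg (\<eta> n)) o\<^sub>L x) * norm (leg (\<xi> n))"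
        by (rule norm_blinfun_compose)
      also have "\<dots> \<le> norm (adj (leg (\<eta> n))) * norm x * norm (leg (\<xi> n))"
        by (intro mult_right_mono norm_blinfun_compose) auto
      also have "\<dots> \<le> norm (\<eta> n) * norm x * norm (\<xi> n)"
        by (intro mult_mono norm_leg_le order_trans[OF norm_adj_le[OF complex_linear_leg] norm_leg_le]) auto
      also have "\<dots> = norm x * (norm (\<eta> n) * norm (\<xi> n))"
        by simp
      also have "\<dots> \<le> norm x * ((norm (\<eta> n))\<^sup>2 + (norm (\<xi> n))\<^sup>2)"
        by (intro mult_left_mono mult_le_sum_power2) auto
      finally show ?thesis .
    qed
  qed auto
  then have "(?s x has_sum infsum (?s x) UNIV) UNIV"
    by (rule has_sum_infsum)
  from has_sum_bounded_linear[OF bounded_linear_compose[OF cinner.bounded_linear_right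
        blinfun.bounded_linear_left] this, of u v]
  show "((\<lambda>n. cinner (t u (\<eta> n)) (blinfun_apply x (t v (\<xi> n)))) has_sum
      cinner u (blinfun_apply (infsum (?s x) UNIV) v)) UNIV"
    by (simp add: cinner_adj_leg)
qed

text \<open>Ultraweak continuity holds because composing a slice with a series of vector functionals
  gives a double series of vector functionals, at the simple tensors of the vectors involved.\<close>

lemma slice_exists:
  assumes "g \<in> ultraweak_functionals"
  shows "\<exists>E. (\<forall>x\<in>bounded_ops. E x \<in> bounded_ops) \<and>
    (\<forall>x y. E (x + y) = E x + E y) \<and> (\<forall>c x. E (c *\<^sub>C x) = c *\<^sub>C E x) \<and>
    continuous_map ultraweak ultraweak E \<and>
    (\<forall>a\<in>bounded_ops. \<forall>b\<in>bounded_ops. E (op_tensor t a b) = g b *\<^sub>C a)"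
proof -
  obtain \<xi> \<eta> :: "nat \<Rightarrow> 'b" where sq: "\<xi> square_summable_on UNIV" "\<eta> square_summable_on UNIV"
    and g: "\<And>T. g T = (\<Sum>\<^sub>\<infinity>n. cinner (\<eta> n) (blinfun_apply T (\<xi> n)))"
    by (rule ultraweak_functionalE[OF assms]) blast
  obtain E :: "('k \<Rightarrow>\<^sub>L 'k) \<Rightarrow> ('a \<Rightarrow>\<^sub>L 'a)" where E: "\<And>x u v.
      ((\<lambda>n. cinner (t u (\<eta> n)) (blinfun_apply x (t v (\<xi> n)))) has_sum cinner u (blinfun_apply (E x) v)) UNIV"
    using slice_operator_exists[OF sq] by blast
  have E_ops: "E x \<in> bounded_ops" if x: "x \<in> bounded_ops" for x
    unfolding bounded_ops_iff complex_linear_def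
  proof (intro allI, rule cinner_ext)
    fix c v u
    have "((\<lambda>n. c * cinner (t u (\<eta> n)) (blinfun_apply x (t v (\<xi> n)))) has_sum
        cinner u (blinfun_apply (E x) (c *\<^sub>C v))) UNIV"
      using E[of u x "c *\<^sub>C v"] x
      by (simp add: tensor_scaleC_left bounded_ops_def cinner_scaleC_right)
    then show "cinner u (blinfun_apply (E x) (c *\<^sub>C v)) = cinner u (c *\<^sub>C blinfun_apply (E x) v)"
      using has_sum_unique has_sum_cmult_right[OF E, of c] unfolding cinner_scaleC_right by blast
  qed
  have E_add: "E (x + y) = E x + E y" for x y
  proof (rule blinfun_eqI, rule cinner_ext)
    fix u v
    show "cinner u (blinfun_apply (E (x + y)) v) = cinner u (blinfun_apply (E x + E y) v)"
      using has_sum_unique[OF E[of u "x + y" v]] has_sum_add[OF E[of u x v] E[of u y v]]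
      by (simp add: blinfun.add_left cinner.add_right)
  qed
  have E_scale: "E (c *\<^sub>C x) = c *\<^sub>C E x" for c x
  proof (rule blinfun_eqI, rule cinner_ext)
    fix u v
    show "cinner u (blinfun_apply (E (c *\<^sub>C x)) v) = cinner u (blinfun_apply (c *\<^sub>C E x) v)"
      using has_sum_unique[OF E[of u "c *\<^sub>C x" v]] has_sum_cmult_right[OF E[of u x v], of c]
      by (simp add: scaleC_blinfun_apply cinner_scaleC_right)
  qed
  have E_cont: "continuous_map ultraweak ultraweak E"
  proof (rule continuous_map_ultraweakI)
    fix f :: "('a \<Rightarrow>\<^sub>L 'a) \<Rightarrow> complex"
    assume "f \<in> ultraweak_functionals"
    then obtain p q :: "nat \<Rightarrow> 'a" where pq: "p square_summable_on UNIV" "q square_summable_on UNIV"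
      and f: "\<And>T. f T = (\<Sum>\<^sub>\<infinity>n. cinner (q n) (blinfun_apply T (p n)))"
      by (rule ultraweak_functionalE) blast
    have prod: "(\<lambda>(m, n). t (r m) (\<zeta> n)) square_summable_on (UNIV \<times> UNIV)"
      if "r square_summable_on UNIV" "\<zeta> square_summable_on UNIV" for r :: "nat \<Rightarrow> 'a" and \<zeta> :: "nat \<Rightarrow> 'b"
    proof (rule summable_on_SigmaI)
      show "((\<lambda>n. (norm (case (m, n) of (m, n) \<Rightarrow> t (r m) (\<zeta> n)))\<^sup>2) has_sum
          (norm (r m))\<^sup>2 * (\<Sum>\<^sub>\<infinity>n. (norm (\<zeta> n))\<^sup>2)) UNIV" for m
        using has_sum_cmult_right[OF has_sum_infsum[OF that(2)], of "(norm (r m))\<^sup>2"]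
        by (simp add: norm_tensor power_mult_distrib)
      show "(\<lambda>m. (norm (r m))\<^sup>2 * (\<Sum>\<^sub>\<infinity>n. (norm (\<zeta> n))\<^sup>2)) summable_on UNIV"
        by (rule summable_on_cmult_left[OF that(1)])
    qed simp
    let ?\<Xi> = "\<lambda>(m, n). t (p m) (\<xi> n)" and ?H = "\<lambda>(m, n). t (q m) (\<eta> n)"
    have "f (E x) = (\<Sum>\<^sub>\<infinity>i\<in>UNIV \<times> UNIV. cinner (?H i) (blinfun_apply x (?\<Xi> i)))" for x
    proof -
      have "f (E x) = (\<Sum>\<^sub>\<infinity>m. \<Sum>\<^sub>\<infinity>n. cinner (?H (m, n)) (blinfun_apply x (?\<Xi> (m, n))))"
        unfolding f prod.case by (intro infsum_cong infsumI[symmetric] E)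
      also have "\<dots> = (\<Sum>\<^sub>\<infinity>i\<in>UNIV \<times> UNIV. cinner (?H i) (blinfun_apply x (?\<Xi> i)))"
        by (rule infsum_Sigma_banach, rule cinner_summable_on[OF prod[OF pq(1) sq(1)] prod[OF pq(2) sq(2)]])
      finally show ?thesis .
    qed
    moreover have "(\<lambda>x. \<Sum>\<^sub>\<infinity>i\<in>UNIV \<times> UNIV. cinner (?H i) (blinfun_apply x (?\<Xi> i))) \<in> ultraweak_functionals"
      by (rule ultraweak_functionalI[OF prod[OF pq(1) sq(1)] prod[OF pq(2) sq(2)]])
    ultimately show "continuous_map ultraweak euclidean (\<lambda>x. f (E x))"
      using continuous_map_ultraweak_functional by simp
  qed (simp add: E_ops)
  have "E (op_tensor t a b) = g b *\<^sub>C a" if "a \<in> bounded_ops" "b \<in> bounded_ops" for a b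
  proof (rule blinfun_eqI, rule cinner_ext)
    fix u v
    have "((\<lambda>n. cinner u (blinfun_apply a v) * cinner (\<eta> n) (blinfun_apply b (\<xi> n))) has_sum
        cinner u (blinfun_apply a v) * g b) UNIV"
      unfolding g by (rule has_sum_cmult_right[OF has_sum_infsum[OF cinner_summable_on[OF sq]]])
    moreover have "((\<lambda>n. cinner u (blinfun_apply a v) * cinner (\<eta> n) (blinfun_apply b (\<xi> n))) has_sum
        cinner u (blinfun_apply (E (op_tensor t a b)) v)) UNIV"
      using E[of u "op_tensor t a b" v] by (simp add: op_tensor_apply that cinner_tensor)
    ultimately show "cinner u (blinfun_apply (E (op_tensor t a b)) v)
        = cinner u (blinfun_apply (g b *\<^sub>C a) v)"
      using has_sum_unique by (fastforce simp: scaleC_blinfun_apply cinner_scaleC_right mult.commute)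
  qed
  then show ?thesis
    using E_ops E_add E_scale E_cont by blast
qed

end

locale tensor_square = tensor_product t
  for t :: "'a::chilbert_space \<Rightarrow> 'a \<Rightarrow> 'k::chilbert_space" +
  fixes M :: "('a \<Rightarrow>\<^sub>L 'a) set"
  assumes vn_M: "von_neumann_algebra M"
begin

abbreviation MM :: "('k \<Rightarrow>\<^sub>L 'k) set"
  where "MM \<equiv> vn_tensor t M M"

lemmas M_ops = von_neumann_algebraD(1)[OF vn_M]
  and M_subspace = complex_subspaceD[OF von_neumann_algebraD(2)[OF vn_M]]
  and M_id = von_neumann_algebraD(3)[OF vn_M]
  and M_closed = von_neumann_algebraD(4)[OF vn_M]

definition simple_tensors :: "('k \<Rightarrow>\<^sub>L 'k) set"
  where "simple_tensors = {op_tensor t a b | a b. a \<in> M \<and> b \<in> M}"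

lemma simple_tensors_ops: "simple_tensors \<subseteq> bounded_ops"
  unfolding simple_tensors_def using M_ops op_tensor_bounded_ops by blast

lemma simple_tensors_scale: "x \<in> simple_tensors \<Longrightarrow> c *\<^sub>C x \<in> simple_tensors"
  unfolding simple_tensors_def using M_ops M_subspace(3) op_tensor_scaleC_left by (smt (verit) mem_Collect_eq subsetD)

lemma MM_eq: "MM = ultraweak closure_of (span simple_tensors)"
  by (simp add: vn_tensor_def simple_tensors_def)

lemma span_simple_tensors_ops: "span simple_tensors \<subseteq> bounded_ops"
  using simple_tensors_ops complex_subspace_imp_subspace[OF complex_subspace_bounded_ops]
  by (rule span_minimal)

lemma MM_subspace: "complex_subspace MM"
  unfolding MM_eq
  by (intro complex_subspace_ultraweak_closure complex_subspace_span simple_tensors_scale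
      span_simple_tensors_ops)

lemma op_tensor_MM: "a \<in> M \<Longrightarrow> b \<in> M \<Longrightarrow> op_tensor t a b \<in> MM"
  unfolding MM_eq
  using span_base[of "op_tensor t a b" simple_tensors]
    closure_of_subset[of "span simple_tensors" ultraweak] span_simple_tensors_ops
  by (auto simp: simple_tensors_def)

text \<open>This justifies the definite descriptions of slice maps and product functionals.\<close>

lemma eq_on_MM:
  assumes "clinear_on MM f" "clinear_on MM g"
    and "continuous_map (subtopology ultraweak MM) Y f" "continuous_map (subtopology ultraweak MM) Y g"
    and "Hausdorff_space Y"
    and "\<And>a b. a \<in> M \<Longrightarrow> b \<in> M \<Longrightarrow> f (op_tensor t a b) = g (op_tensor t a b)"
    and "x \<in> MM"
  shows "f x = g x"
  by (rule clinear_eq_on_ultraweak_closure[OF simple_tensors_ops simple_tensors_scale MM_eq assms(1-5) _ assms(7)])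
    (use assms(6) in \<open>auto simp: simple_tensors_def\<close>)

definition normal_functional :: "(('a \<Rightarrow>\<^sub>L 'a) \<Rightarrow> complex) \<Rightarrow> bool"
  where "normal_functional \<phi> \<longleftrightarrow> clinear_on M \<phi> \<and> ultraweakly_continuous_functional M \<phi>"

text \<open>The functional \<open>\<phi>\<close> on \<open>M\<close> extends to a series of vector functionals, which can be sliced on
  all bounded operators.  On simple tensors over \<open>M\<close> the slice takes values in \<open>M\<close>; by
  continuity and ultraweak closedness of \<open>M\<close> it does so on the whole tensor product.\<close>

lemma slice_map_is_slice:
  assumes \<phi>: "normal_functional \<phi>"
  shows "slice_map t M \<phi> \<in> MM \<rightarrow>\<^sub>E M \<and> clinear_on MM (slice_map t M \<phi>) \<and>
    ultraweakly_continuous_map MM M (slice_map t M \<phi>) \<and>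
    (\<forall>a\<in>M. \<forall>b\<in>M. slice_map t M \<phi> (op_tensor t a b) = \<phi> b *\<^sub>C a)"
proof -
  obtain g where g: "g \<in> ultraweak_functionals" "\<And>x. x \<in> M \<Longrightarrow> \<phi> x = g x"
    using ultraweakly_continuous_functional_extends[OF von_neumann_algebraD(2)[OF vn_M] M_ops] \<phi>
    unfolding normal_functional_def by blast
  obtain E where E: "\<And>x. x \<in> bounded_ops \<Longrightarrow> E x \<in> bounded_ops" "\<And>x y. E (x + y) = E x + E y"
      "\<And>c x. E (c *\<^sub>C x) = c *\<^sub>C E x" "continuous_map ultraweak ultraweak E"
      "\<And>a b. a \<in> bounded_ops \<Longrightarrow> b \<in> bounded_ops \<Longrightarrow> E (op_tensor t a b) = g b *\<^sub>C a"
    using slice_exists[OF g(1)] by blast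
  have E_simple: "E (op_tensor t a b) = \<phi> b *\<^sub>C a" if "a \<in> M" "b \<in> M" for a b
    using that M_ops by (auto simp: g(2) intro!: E(5))
  have "E 0 = 0"
    using E(3)[of 0 0] by simp
  then have "complex_subspace {x. E x \<in> M}"
    using M_subspace by (simp add: complex_subspace_def E(2,3))
  then have "span simple_tensors \<subseteq> {x. E x \<in> M}"
    by (intro span_minimal complex_subspace_imp_subspace)
      (auto simp: simple_tensors_def E_simple M_subspace)
  then have "E ` span simple_tensors \<subseteq> M"
    by blast
  moreover have "E ` MM \<subseteq> ultraweak closure_of (E ` span simple_tensors)"
    unfolding MM_eq by (rule continuous_map_image_closure_subset[OF E(4)])
  ultimately have E_M: "E ` MM \<subseteq> M"
    using closure_of_mono M_closed by blast
  define E' where "E' = restrict E MM"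
  note MM_sub = complex_subspaceD[OF MM_subspace]
  have cont: "continuous_map (subtopology ultraweak MM) (subtopology ultraweak M) E'"
  proof (rule continuous_map_into_subtopology)
    show "continuous_map (subtopology ultraweak MM) ultraweak E'"
      by (rule continuous_map_eq[OF continuous_map_from_subtopology[OF E(4)]]) (auto simp: E'_def)
  qed (use E_M in \<open>auto simp: E'_def\<close>)
  have "\<exists>!F. F \<in> MM \<rightarrow>\<^sub>E M \<and> clinear_on MM F \<and> ultraweakly_continuous_map MM M F \<and>
      (\<forall>a\<in>M. \<forall>b\<in>M. F (op_tensor t a b) = \<phi> b *\<^sub>C a)"
  proof (rule ex1I[of _ E'])
    show "E' \<in> MM \<rightarrow>\<^sub>E M \<and> clinear_on MM E' \<and> ultraweakly_continuous_map MM M E' \<and>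
        (\<forall>a\<in>M. \<forall>b\<in>M. E' (op_tensor t a b) = \<phi> b *\<^sub>C a)"
      using cont E_M MM_sub
      by (auto simp: E'_def clinear_on_def E(2,3) ultraweakly_continuous_map_def E_simple op_tensor_MM)
    show "F = E'" if F: "F \<in> MM \<rightarrow>\<^sub>E M \<and> clinear_on MM F \<and> ultraweakly_continuous_map MM M F \<and>
        (\<forall>a\<in>M. \<forall>b\<in>M. F (op_tensor t a b) = \<phi> b *\<^sub>C a)" for F
    proof (rule extensionalityI[of _ MM])
      fix x assume x: "x \<in> MM"
      show "F x = E' x"
      proof (rule eq_on_MM[OF _ _ _ cont _ _ x])
        show "clinear_on MM E'"
          using MM_sub by (auto simp: E'_def clinear_on_def E(2,3))
        show "Hausdorff_space (subtopology ultraweak M)"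
          by (intro Hausdorff_space_subtopology Hausdorff_ultraweak)
        show "F (op_tensor t a b) = E' (op_tensor t a b)" if "a \<in> M" "b \<in> M" for a b
          using F that by (simp add: E'_def op_tensor_MM E_simple)
      qed (use F in \<open>auto simp: ultraweakly_continuous_map_def\<close>)
    qed (use F in \<open>auto simp: E'_def PiE_def\<close>)
  qed
  then show ?thesis
    unfolding slice_map_def by (rule theI')
qed

text \<open>A slice map depends on the values of the functional on \<open>M\<close> only, so equality of states on
  \<open>M\<close> can be used inside a slice map.\<close>

lemma slice_map_cong:
  assumes "\<And>b. b \<in> M \<Longrightarrow> \<phi> b = \<psi> b"
  shows "slice_map t M \<phi> = slice_map t M \<psi>"
  unfolding slice_map_def using assms by (simp cong: ball_cong)

lemma normal_functional_comp:
  assumes \<phi>: "normal_functional \<phi>"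
    and E: "E \<in> N \<rightarrow> M" "clinear_on N E" "ultraweakly_continuous_map N M E"
  shows "clinear_on N (\<lambda>x. \<phi> (E x))" "ultraweakly_continuous_functional N (\<lambda>x. \<phi> (E x))"
proof -
  show "clinear_on N (\<lambda>x. \<phi> (E x))"
    using \<phi> E by (auto simp: normal_functional_def clinear_on_def Pi_iff)
  show "ultraweakly_continuous_functional N (\<lambda>x. \<phi> (E x))"
    using continuous_map_compose[of _ _ E _ \<phi>] \<phi> E(3)
    by (simp add: normal_functional_def ultraweakly_continuous_functional_def
        ultraweakly_continuous_map_def o_def)
qed

text \<open>Slicing the second factor by \<open>\<psi>\<close> and then applying \<open>\<phi>\<close> is continuous and has the values
  \<open>\<phi> a * \<psi> b\<close>.  This identity turns the definition of the states \<open>\<psi> t\<close> into a statement about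
  slice maps.\<close>

lemma functional_tensor_eq:
  assumes \<phi>: "normal_functional \<phi>" and \<psi>: "normal_functional \<psi>" and x: "x \<in> MM"
  shows "functional_tensor t M \<phi> \<psi> x = \<phi> (slice_map t M \<psi> x)"
proof -
  let ?E = "slice_map t M \<psi>"
  define f where "f = restrict (\<lambda>x. \<phi> (?E x)) MM"
  have E: "?E \<in> MM \<rightarrow> M" "clinear_on MM ?E" "ultraweakly_continuous_map MM M ?E"
      "\<And>a b. a \<in> M \<Longrightarrow> b \<in> M \<Longrightarrow> ?E (op_tensor t a b) = \<psi> b *\<^sub>C a"
    using slice_map_is_slice[OF \<psi>] by (auto simp: PiE_def)
  note comp = normal_functional_comp[OF \<phi> E(1-3)]
  have f_lin: "clinear_on MM f"
    using comp(1) complex_subspaceD[OF MM_subspace] by (simp add: f_def clinear_on_def)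
  have f_cont: "continuous_map (subtopology ultraweak MM) euclidean f"
    using comp(2) unfolding ultraweakly_continuous_functional_def
    by (rule continuous_map_eq) (simp add: f_def)
  have f_simple: "f (op_tensor t a b) = \<phi> a * \<psi> b" if "a \<in> M" "b \<in> M" for a b
    using \<phi> that
    by (simp add: f_def op_tensor_MM E normal_functional_def clinear_on_def scaleC_complex_def)
  have "functional_tensor t M \<phi> \<psi> = f"
    unfolding functional_tensor_def
  proof (rule the_equality)
    show "f \<in> extensional MM \<and> clinear_on MM f \<and> ultraweakly_continuous_functional MM f \<and>
        (\<forall>a\<in>M. \<forall>b\<in>M. f (op_tensor t a b) = \<phi> a * \<psi> b)"
      using f_lin f_cont f_simple by (simp add: ultraweakly_continuous_functional_def f_def)
    show "h = f" if h: "h \<in> extensional MM \<and> clinear_on MM h \<and> ultraweakly_continuous_functional MM h \<and>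
        (\<forall>a\<in>M. \<forall>b\<in>M. h (op_tensor t a b) = \<phi> a * \<psi> b)" for h
    proof (rule extensionalityI[of _ MM])
      fix y assume y: "y \<in> MM"
      show "h y = f y"
        by (rule eq_on_MM[OF _ f_lin _ f_cont _ _ y])
          (use h f_simple in \<open>auto simp: ultraweakly_continuous_functional_def Hausdorff_space_euclidean\<close>)
    qed (use h in \<open>auto simp: f_def\<close>)
  qed
  then show ?thesis
    using x by (simp add: f_def)
qed

lemma normal_ucp_amplification: "normal_ucp_map M MM (\<lambda>x. op_tensor t x id_blinfun)"
  unfolding normal_ucp_map_def
proof (intro conjI)
  show "clinear_on M (\<lambda>x. op_tensor t x id_blinfun)"
    using M_ops
    by (auto simp: clinear_on_def id_bounded_ops intro!: op_tensor_add_left op_tensor_scaleC_left)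
  show "ultraweakly_continuous_map M MM (\<lambda>x. op_tensor t x id_blinfun)"
    unfolding ultraweakly_continuous_map_def
    by (rule continuous_map_into_subtopology[OF continuous_map_amplification[OF M_ops]])
      (auto simp: op_tensor_MM M_id)
qed (auto simp: op_tensor_MM M_id op_tensor_id completely_positive_on_amplification M_ops)

end

lemma normal_ucp_map_comp:
  assumes S: "normal_ucp_map M N S" and T: "normal_ucp_map N R T"
  shows "normal_ucp_map M R (\<lambda>x. T (S x))"
  unfolding normal_ucp_map_def
proof (intro conjI)
  have SN: "S x \<in> N" if "x \<in> M" for x
    using S that by (auto simp: normal_ucp_map_def)
  show "(\<lambda>x. T (S x)) \<in> M \<rightarrow> R"
    using S T by (auto simp: normal_ucp_map_def)
  show "clinear_on M (\<lambda>x. T (S x))"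
    using S T SN by (simp add: normal_ucp_map_def clinear_on_def)
  show "ultraweakly_continuous_map M R (\<lambda>x. T (S x))"
    using S T continuous_map_compose[of _ "subtopology ultraweak N" S _ T]
    by (simp add: normal_ucp_map_def ultraweakly_continuous_map_def o_def)
  show "T (S id_blinfun) = id_blinfun"
    using S T by (simp add: normal_ucp_map_def)
  show "completely_positive_on M (\<lambda>x. T (S x))"
    using S T SN by (simp add: normal_ucp_map_def completely_positive_on_def)
qed

lemma normal_ucp_map_cong:
  assumes S: "normal_ucp_map M N S" and M: "complex_subspace M" "id_blinfun \<in> M"
    and eq: "\<And>x. x \<in> M \<Longrightarrow> T x = S x"
  shows "normal_ucp_map M N T"
  unfolding normal_ucp_map_def
proof (intro conjI)
  have S': "continuous_map (subtopology ultraweak M) (subtopology ultraweak N) S" "completely_positive_on M S"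
    using S by (simp_all add: normal_ucp_map_def ultraweakly_continuous_map_def)
  show "ultraweakly_continuous_map M N T"
    unfolding ultraweakly_continuous_map_def by (rule continuous_map_eq[OF S'(1)]) (simp add: eq)
  show "completely_positive_on M T"
    unfolding completely_positive_on_def
  proof (intro allI impI)
    fix n X
    assume X: "\<forall>i<n. \<forall>j<n. X i j \<in> M" and pos: "positive_matrix n X"
    have "(\<Sum>i<n. \<Sum>j<n. cinner (\<xi> i) (blinfun_apply (T (X i j)) (\<xi> j)))
        = (\<Sum>i<n. \<Sum>j<n. cinner (\<xi> i) (blinfun_apply (S (X i j)) (\<xi> j)))" for \<xi>
      using X by (intro sum.cong refl) (simp add: eq)
    moreover have "positive_matrix n (\<lambda>i j. S (X i j))"
      using S'(2) X pos unfolding completely_positive_on_def by blast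
    ultimately show "positive_matrix n (\<lambda>i j. T (X i j))"
      unfolding positive_matrix_def by simp
  qed
  have M': "x + y \<in> M" "c *\<^sub>C x \<in> M" if "x \<in> M" "y \<in> M" for x y c
    using complex_subspaceD[OF M(1)] that by auto
  have S'': "S \<in> M \<rightarrow> N" "clinear_on M S" "S id_blinfun = id_blinfun"
    using S by (simp_all add: normal_ucp_map_def)
  show "T \<in> M \<rightarrow> N"
    using S''(1) by (auto simp: eq)
  show "clinear_on M T"
    using S''(2) M' by (simp add: clinear_on_def eq)
  show "T id_blinfun = id_blinfun"
    using S''(3) M(2) by (simp add: eq)
qed

section \<open>Markov processes and the quadratic process\<close>

theorem theorem3p2:
  fixes tens :: "'h::chilbert_space \<Rightarrow> 'h \<Rightarrow> 'k::chilbert_space"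
    and M :: "('h \<Rightarrow>\<^sub>L 'h) set"
    and MM :: "('k \<Rightarrow>\<^sub>L 'k) set"
    and \<omega>\<^sub>0 :: "('h \<Rightarrow>\<^sub>L 'h) \<Rightarrow> complex"
    and Q :: "real \<Rightarrow> real \<Rightarrow> ('h \<Rightarrow>\<^sub>L 'h) \<Rightarrow> ('h \<Rightarrow>\<^sub>L 'h)"
    and H :: "real \<Rightarrow> real \<Rightarrow> ('k \<Rightarrow>\<^sub>L 'k) \<Rightarrow> ('k \<Rightarrow>\<^sub>L 'k)"
    and \<phi> \<psi> :: "real \<Rightarrow> ('h \<Rightarrow>\<^sub>L 'h) \<Rightarrow> complex"
    and P :: "real \<Rightarrow> real \<Rightarrow> ('h \<Rightarrow>\<^sub>L 'h) \<Rightarrow> ('k \<Rightarrow>\<^sub>L 'k)"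
  assumes tens: "hilbert_tensor tens"
    and M: "von_neumann_algebra M"
    and MM: "MM = vn_tensor tens M M"
    and \<omega>\<^sub>0: "normal_state M \<omega>\<^sub>0"
    and Q: "markov_process M Q"
    and H: "markov_process MM H"
    and \<phi>_0: "\<And>x. x \<in> M \<Longrightarrow> \<phi> 0 x = \<omega>\<^sub>0 x"
    and \<phi>_t: "\<And>t x. t \<ge> 1 \<Longrightarrow> x \<in> M \<Longrightarrow> \<phi> t x = \<omega>\<^sub>0 (Q 0 t x)"
    and \<psi>_0: "\<And>x. x \<in> M \<Longrightarrow> \<psi> 0 x = \<omega>\<^sub>0 x"
    and \<psi>_t: "\<And>t x. t \<ge> 1 \<Longrightarrow> x \<in> M \<Longrightarrow>
      \<psi> t x = functional_tensor tens M \<omega>\<^sub>0 \<omega>\<^sub>0 (H 0 t (op_tensor tens x id_blinfun))"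
    and i: "\<And>s t x. s \<ge> 0 \<Longrightarrow> t - s \<ge> 1 \<Longrightarrow> x \<in> MM \<Longrightarrow>
      flip_map tens M (H s t x) = H s t x"
    and ii: "\<And>s t x. s = 0 \<or> s \<ge> 1 \<Longrightarrow> t - s \<ge> 1 \<Longrightarrow> x \<in> MM \<Longrightarrow>
      slice_map tens M (\<psi> s) (H s t x) = Q s t (slice_map tens M (\<phi> t) x)"
    and iii: "\<And>s t x. s \<ge> 0 \<Longrightarrow> t - s \<ge> 1 \<Longrightarrow> x \<in> MM \<Longrightarrow>
      H s t x = H s t (op_tensor tens (slice_map tens M (\<psi> t) x) id_blinfun)"
    and P: "\<And>s t x. s \<ge> 0 \<Longrightarrow> t - s \<ge> 1 \<Longrightarrow> x \<in> M \<Longrightarrow>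
      P s t x = H s t (op_tensor tens x id_blinfun)"
  shows "(\<forall>t. t = 0 \<or> t \<ge> 1 \<longrightarrow> (\<forall>x\<in>M. \<phi> t x = \<psi> t x)) \<and>
    qqsp_type_A tens M P \<omega>\<^sub>0 \<and>
    (\<forall>s \<tau> t. s \<ge> 0 \<longrightarrow> \<tau> - s \<ge> 1 \<longrightarrow> t - \<tau> \<ge> 1 \<longrightarrow>
      (\<forall>x\<in>M. P s t x = H s \<tau> (P \<tau> t x))) \<and>
    (\<forall>s t. s = 0 \<or> s \<ge> 1 \<longrightarrow> t - s \<ge> 1 \<longrightarrow>
      (\<forall>x\<in>M. Q s t x = slice_map tens M (\<phi> s) (P s t x)))"
proof -
  interpret tensor_square tens M
    by unfold_locales (fact tens, fact M)
  let ?amp = "\<lambda>x. op_tensor tens x id_blinfun"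
  let ?E = "slice_map tens M"
  note M_complex = von_neumann_algebraD(2)[OF M]
  have Q_ucp: "normal_ucp_map M M (Q s t)" if "s \<ge> 0" "t - s \<ge> 1" for s t
    using Q that by (simp add: markov_process_def)
  have H_ucp: "normal_ucp_map MM MM (H s t)" if "s \<ge> 0" "t - s \<ge> 1" for s t
    using H that by (simp add: markov_process_def)
  have H_comp: "H s t x = H s \<tau> (H \<tau> t x)" if "s \<ge> 0" "\<tau> - s \<ge> 1" "t - \<tau> \<ge> 1" "x \<in> MM" for s \<tau> t x
    using H that unfolding markov_process_def by blast
  note amp = normal_ucp_amplification[folded MM]
  have amp_MM: "?amp x \<in> MM" if "x \<in> M" for x
    using that M_id op_tensor_MM MM by simp
  have HA_ucp: "normal_ucp_map M MM (\<lambda>x. H s t (?amp x))" if "s \<ge> 0" "t - s \<ge> 1" for s t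
    by (rule normal_ucp_map_comp[OF amp H_ucp[OF that]])
  have H_MM: "H s t x \<in> MM" if "s \<ge> 0" "t - s \<ge> 1" "x \<in> MM" for s t x
    using H_ucp[OF that(1,2)] that(3) by (auto simp: normal_ucp_map_def)
  have \<omega>\<^sub>0_normal: "normal_functional \<omega>\<^sub>0" and \<omega>\<^sub>0_id: "\<omega>\<^sub>0 id_blinfun = 1"
    using \<omega>\<^sub>0 by (auto simp: normal_state_def normal_functional_def)
  have normal_cong: "normal_functional f" if "normal_functional f'" "\<And>x. x \<in> M \<Longrightarrow> f x = f' x"
    for f f'
    using that M_subspace
    by (auto simp: normal_functional_def clinear_on_def ultraweakly_continuous_functional_def
        elim!: continuous_map_eq)
  have \<phi>_normal: "normal_functional (\<phi> t)" if "t \<ge> 1" for t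
  proof (rule normal_cong)
    show "normal_functional (\<lambda>x. \<omega>\<^sub>0 (Q 0 t x))"
      using normal_functional_comp[OF \<omega>\<^sub>0_normal, of "Q 0 t" M] Q_ucp[of 0 t] that
      by (simp add: normal_ucp_map_def normal_functional_def)
  qed (use \<phi>_t that in simp)
  have \<phi>_id: "\<phi> t id_blinfun = 1" if "t \<ge> 1" for t
    using \<phi>_t[OF that M_id] Q_ucp[of 0 t] that \<omega>\<^sub>0_id by (simp add: normal_ucp_map_def)
  \<comment> \<open>On an amplified element, hypothesis \<open>ii\<close> loses the slice on its right-hand side, because
    \<open>\<phi> t\<close> is normalised.\<close>
  have Q_slice: "?E (\<psi> s) (H s t (?amp x)) = Q s t x"
    if "s = 0 \<or> s \<ge> 1" "t - s \<ge> 1" "x \<in> M" for s t x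
  proof -
    have "t \<ge> 1"
      using that by auto
    then have "?E (\<phi> t) (?amp x) = x"
      using slice_map_is_slice[OF \<phi>_normal] that(3) M_id \<phi>_id by simp
    then show ?thesis
      using ii[OF that(1,2) amp_MM[OF that(3)]] by simp
  qed
  have \<phi>_\<psi>: "\<phi> t x = \<psi> t x" if t: "t = 0 \<or> t \<ge> 1" and x: "x \<in> M" for t x
  proof (cases "t \<ge> 1")
    case True
    have "\<psi> t x = \<omega>\<^sub>0 (?E \<omega>\<^sub>0 (H 0 t (?amp x)))"
      using \<psi>_t[OF True x] functional_tensor_eq[OF \<omega>\<^sub>0_normal \<omega>\<^sub>0_normal] H_MM[of 0 t] amp_MM[OF x] True MM
      by simp
    also have "?E \<omega>\<^sub>0 = ?E (\<psi> 0)"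
      by (rule slice_map_cong) (simp add: \<psi>_0)
    also have "?E (\<psi> 0) (H 0 t (?amp x)) = Q 0 t x"
      using Q_slice[of 0 t x] True x by simp
    finally show ?thesis
      using \<phi>_t[OF True x] by simp
  next
    case False
    then show ?thesis
      using t x \<phi>_0 \<psi>_0 by simp
  qed
  have E_\<phi>_\<psi>: "?E (\<phi> t) = ?E (\<psi> t)" if "t = 0 \<or> t \<ge> 1" for t
    by (rule slice_map_cong) (rule \<phi>_\<psi>[OF that])
  have P_H: "P s t x = H s \<tau> (P \<tau> t x)" if "s \<ge> 0" "\<tau> - s \<ge> 1" "t - \<tau> \<ge> 1" "x \<in> M" for s \<tau> t x
    using P[of s t x] P[of \<tau> t x] H_comp[OF that(1-3) amp_MM[OF that(4)]] that by simp
  have P_ucp: "normal_ucp_map M MM (P s t)" if "s \<ge> 0" "t - s \<ge> 1" for s t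
    by (rule normal_ucp_map_cong[OF HA_ucp[OF that] M_complex M_id]) (rule P[OF that])
  have P_flip: "flip_map tens M (P s t x) = P s t x" if "s \<ge> 0" "t - s \<ge> 1" "x \<in> M" for s t x
    using i[OF that(1,2) amp_MM[OF that(3)]] P[OF that] by simp
  have P_MM: "P s t x \<in> MM" if "s \<ge> 0" "t - s \<ge> 1" "x \<in> M" for s t x
    using P_ucp[OF that(1,2)] that(3) by (auto simp: normal_ucp_map_def)
  have P_comp: "P s t x = P s \<tau> (?E (\<lambda>y. functional_tensor tens M \<omega>\<^sub>0 \<omega>\<^sub>0 (P 0 \<tau> y)) (P \<tau> t x))"
    if st: "s \<ge> 0" "\<tau> - s \<ge> 1" "t - \<tau> \<ge> 1" and x: "x \<in> M" for s \<tau> t x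
  proof -
    have \<tau>: "\<tau> \<ge> 1"
      using st by simp
    have "?E (\<lambda>y. functional_tensor tens M \<omega>\<^sub>0 \<omega>\<^sub>0 (P 0 \<tau> y)) = ?E (\<psi> \<tau>)"
      by (rule slice_map_cong) (use \<tau> P \<psi>_t in simp)
    moreover have "normal_functional (\<psi> \<tau>)"
      by (rule normal_cong[OF \<phi>_normal[OF \<tau>]]) (use \<phi>_\<psi> \<tau> in simp)
    then have "?E (\<psi> \<tau>) (P \<tau> t x) \<in> M"
      using slice_map_is_slice P_MM[of \<tau> t x] st x MM by auto
    ultimately show ?thesis
      using P_H[OF st x] iii[OF st(1,2) P_MM[of \<tau> t x]] P[OF st(1,2)] st x by simp
  qed
  have "qqsp_type_A tens M P \<omega>\<^sub>0"
    unfolding qqsp_type_A_def Let_def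
    using \<omega>\<^sub>0 P_ucp P_flip P_comp unfolding MM by blast
  moreover have "Q s t x = ?E (\<phi> s) (P s t x)" if "s = 0 \<or> s \<ge> 1" "t - s \<ge> 1" "x \<in> M" for s t x
    using Q_slice[OF that] E_\<phi>_\<psi>[OF that(1)] P[of s t x] that by auto
  ultimately show ?thesis
    using \<phi>_\<psi> P_H by blast
qed

end
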